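(* Let $d \geq 3$ and $N \geq 2$ be integers, and let $\tau$ be the probability measure on $\{1,\ldots,N\}^d$ given by $$\tau(\mathbf{i})=\begin{cases}\frac{1}{N^{d-1}} & \text{if } \sum_{j=1}^d (i_j-1) \in \{0,N,2N,\ldots\},\\ 0 & \text{otherwise.}\end{cases}$$ Then $\tau \in \mathcal{U}_d^N$, and the resulting measure $\mu_\tau^\star$ has the following properties: (P1) $\mu_\tau^\star$ is an element of $\mathcal{P}_d^{\lambda_{d-1}}$. (P2) $\mu_\tau^\star$ is singular with respect to $\lambda_d$, and its support is a self-similar set with Hausdorff dimension $d-1$. (P3) If $\mathbf{X}=(X_1,\ldots,X_d)$ is a random vector with distribution $\mu_\tau^\star$, then each variable $X_j$ is almost surely a (measurable) function of the other $d-1$ variables.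
   Context: $\lambda_k$ denotes Lebesgue measure on $[0,1]^k$, $\lambda=\lambda_1$. A Borel probability measure $\mu$ on $[0,1]^d$ is $d$-stochastic if each of its univariate marginals is $\lambda$; $\mathcal{P}_d$ is the family of all $d$-stochastic measures. For $j_0 \in \{1,\ldots,d\}$, $\pi_{-j_0}:[0,1]^d\to[0,1]^{d-1}$ is the projection deleting the $j_0$-th coordinate. $\mathcal{P}_d^{\lambda_{d-1}}$ is the family of all $\mu\in\mathcal{P}_d$ whose push-forward $\mu^{\pi_{-j_0}}$ equals $\lambda_{d-1}$ for every $j_0\in\{1,\ldots,d\}$. Generalized transformation matrices. Let $\mathbf{m}=(m_1,\ldots,m_d)\in\mathbb{N}^d$ with $\min_j m_j\ge 2$ and $\mathcal{I}_d^{\mathbf{m}}=\{1,\ldots,m_1\}\times\cdots\times\{1,\ldots,m_d\}$. A probability distribution $\tau$ on $\mathcal{I}_d^{\mathbf{m}}$ (point masses $\tau(\mathbf{i})$, $\mathbf{i}=(i_1,\ldots,i_d)$) is a generalized transformation matrix, $\tau\in\mathcal{T}_d^{\mathbf{m}}$, if $\sum_{\mathbf{i}:\,i_j=k}\tau(\mathbf{i})>0$ for all $j\in\{1,\ldots,d\}$, $k\in\{1,\ldots,m_j\}$. Set $\mathcal{S}_\tau=\{\mathbf{i}:\tau(\mathbf{i})>0\}$, $a^j_0=0$, $a^j_k=\sum_{\mathbf{i}:\,i_j\le k}\tau(\mathbf{i})$, $E^j_k=[a^j_{k-1},a^j_k]$, and define $f_{\mathbf{i}}:[0,1]^d\to[0,1]^d$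 as the map whose $j$-th coordinate is $a^j_{i_j-1}+(a^j_{i_j}-a^j_{i_j-1})x_j$. The Markov operator on Borel probability measures on $[0,1]^d$ is $\mathcal{V}_\tau(\mu)=\sum_{\mathbf{i}\in\mathcal{S}_\tau}\tau(\mathbf{i})\,\mu^{f_{\mathbf{i}}}$ ($\mu^{f}$ is the push-forward of $\mu$ under $f$), and $\mu_\tau^\star$ denotes its unique fixed point (which exists because the $f_{\mathbf{i}}$ are contractions). Uniformity condition. $\tau\in\mathcal{T}_d^{\mathbf{m}}$ fulfills the uniformity condition w.r.t. coordinate $j_0$ if $$\sum_{l=1}^{m_{j_0}}\tau(i_1,\ldots,i_{j_0-1},l,i_{j_0+1},\ldots,i_d)=\prod_{j\ne j_0}\lambda(E^j_{i_j})$$ for all choices of $i_j\in\{1,\ldots,m_j\}$, $j\neq j_0$. $\mathcal{U}_d^N$ is the family of all $\tau\in\mathcal{T}_d^{\mathbf{m}}$ with $\mathbf{m}=(N,\ldots,N)$ such that $E^j_k=[\frac{k-1}{N},\frac{k}{N}]$ for all $j\in\{1,\ldots,d\}$, $k\in\{1,\ldots,N\}$, and $\tau$ fulfills the uniformity condition w.r.t. every coordinate. A non-empty compact set $Z$ is self-similar if it is a finite union of shrunk copies of itself, i.e. $Z=\bigcup_{i=1}^m g_i(Z)$ for some $m\ge2$ and contracting similarities $g_1,\ldots,g_m$ (maps with $\rho(g_i(x),g_i(y))=c_i\,\rho(x,y)$ for all $x,y$, with $\rho$ the Euclidean metric and $0<c_i<1$). *)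

theory Defs
  imports "HOL-Probability.Probability"
begin

text \<open>
  The dimension \<open>d\<close> is \<open>CARD('n)\<close> for an arbitrary finite index type \<open>'n\<close>; coordinates are
  indexed by \<open>'n\<close> instead of \<open>{1..d}\<close>.
\<close>

definition unit_borel :: "real measure" where
  "unit_borel = restrict_space borel {0..1}"

definition unit_lebesgue :: "real measure" where
  "unit_lebesgue = restrict_space lborel {0..1}"

definition cube :: "(real ^ 'n) set" where
  "cube = {x. \<forall>j. x $ j \<in> {0..1}}"

definition cube_borel :: "(real ^ 'n) measure" where
  "cube_borel = restrict_space borel cube"

definition cube_lebesgue :: "(real ^ 'n) measure" where
  "cube_lebesgue = restrict_space lborel cube"

definition cube_probs :: "(real ^ 'n) measure set" where
  "cube_probs = {\<mu>. prob_space \<mu> \<and> sets \<mu> = sets cube_borel}"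

definition stochastic_measures :: "(real ^ 'n) measure set" where
  "stochastic_measures =
     {\<mu> \<in> cube_probs. \<forall>j. distr \<mu> unit_borel (\<lambda>x. x $ j) = unit_lebesgue}"

text \<open>
  Deleting coordinate \<open>j0\<close> lands in \<open>[0,1]\<close>-valued functions on the index set \<open>- {j0}\<close>, which
  has \<open>d - 1\<close> elements.  There the Borel sets are those of the finite product of
  \<^const>\<open>unit_borel\<close>, and \<open>(d - 1)\<close>-dimensional Lebesgue measure is the finite product
  of \<^const>\<open>unit_lebesgue\<close>.
\<close>

definition proj_del :: "'n \<Rightarrow> real ^ 'n \<Rightarrow> 'n \<Rightarrow> real" where
  "proj_del j0 x = (\<lambda>j\<in>- {j0}. x $ j)"

definition face_borel :: "'n \<Rightarrow> ('n \<Rightarrow> real) measure" where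
  "face_borel j0 = PiM (- {j0}) (\<lambda>_. unit_borel)"

definition face_lebesgue :: "'n \<Rightarrow> ('n \<Rightarrow> real) measure" where
  "face_lebesgue j0 = PiM (- {j0}) (\<lambda>_. unit_lebesgue)"

definition stochastic_measures_uniform_faces :: "(real ^ 'n) measure set" where
  "stochastic_measures_uniform_faces =
     {\<mu> \<in> stochastic_measures. \<forall>j0. distr \<mu> (face_borel j0) (proj_del j0) = face_lebesgue j0}"

definition singular_wrt :: "'a measure \<Rightarrow> 'a measure \<Rightarrow> bool" where
  "singular_wrt \<mu> \<nu> \<longleftrightarrow>
     (\<exists>A \<in> sets \<mu> \<inter> sets \<nu>. emeasure \<mu> A = 0 \<and> emeasure \<nu> (space \<nu> - A) = 0)"

text \<open>Neighbourhoods are taken relative to the space of the measure.\<close>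

definition measure_support :: "'a::topological_space measure \<Rightarrow> 'a set" where
  "measure_support \<mu> =
     {x \<in> space \<mu>. \<forall>U. open U \<and> x \<in> U \<longrightarrow> emeasure \<mu> (U \<inter> space \<mu>) > 0}"

definition multi_indices :: "('n \<Rightarrow> nat) \<Rightarrow> ('n \<Rightarrow> nat) set" where
  "multi_indices m = {i. \<forall>j. i j \<in> {1..m j}}"

text \<open>
  A probability distribution on the finite set \<^term>\<open>multi_indices m\<close> is given by its point masses,
  extended by zero to all of \<^typ>\<open>'n \<Rightarrow> nat\<close>.
\<close>

definition gen_transformation_matrices ::
    "('n::finite \<Rightarrow> nat) \<Rightarrow> (('n \<Rightarrow> nat) \<Rightarrow> real) set" where
  "gen_transformation_matrices m =
     {\<tau>. (\<forall>j. m j \<ge> 2) \<and>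
         (\<forall>i. \<tau> i \<ge> 0) \<and> (\<forall>i. i \<notin> multi_indices m \<longrightarrow> \<tau> i = 0) \<and>
         (\<Sum>i\<in>multi_indices m. \<tau> i) = 1 \<and>
         (\<forall>j. \<forall>k\<in>{1..m j}. (\<Sum>i\<in>{i \<in> multi_indices m. i j = k}. \<tau> i) > 0)}"

definition mass_support :: "(('n \<Rightarrow> nat) \<Rightarrow> real) \<Rightarrow> ('n \<Rightarrow> nat) set" where
  "mass_support \<tau> = {i. \<tau> i > 0}"

definition cut :: "('n::finite \<Rightarrow> nat) \<Rightarrow> (('n \<Rightarrow> nat) \<Rightarrow> real) \<Rightarrow> 'n \<Rightarrow> nat \<Rightarrow> real" where
  "cut m \<tau> j k = (\<Sum>i\<in>{i \<in> multi_indices m. i j \<le> k}. \<tau> i)"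

definition cell :: "('n::finite \<Rightarrow> nat) \<Rightarrow> (('n \<Rightarrow> nat) \<Rightarrow> real) \<Rightarrow> 'n \<Rightarrow> nat \<Rightarrow> real set" where
  "cell m \<tau> j k = {cut m \<tau> j (k - 1)..cut m \<tau> j k}"

definition contraction ::
    "('n::finite \<Rightarrow> nat) \<Rightarrow> (('n \<Rightarrow> nat) \<Rightarrow> real) \<Rightarrow> ('n \<Rightarrow> nat) \<Rightarrow> real ^ 'n \<Rightarrow> real ^ 'n" where
  "contraction m \<tau> i x =
     (\<chi> j. cut m \<tau> j (i j - 1) + (cut m \<tau> j (i j) - cut m \<tau> j (i j - 1)) * x $ j)"

definition markov_operator ::
    "('n::finite \<Rightarrow> nat) \<Rightarrow> (('n \<Rightarrow> nat) \<Rightarrow> real) \<Rightarrow> (real ^ 'n) measure \<Rightarrow> (real ^ 'n) measure" where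
  "markov_operator m \<tau> \<mu> =
     measure_of cube (sets cube_borel)
       (\<lambda>A. \<Sum>i\<in>mass_support \<tau>.
              ennreal (\<tau> i) * emeasure (distr \<mu> cube_borel (contraction m \<tau> i)) A)"

text \<open>
  The definite description is meaningful for \<open>\<tau> \<in> gen_transformation_matrices m\<close>, where the Markov
  operator has exactly one fixed point among the Borel probability measures on the cube.
\<close>

definition invariant_measure ::
    "('n::finite \<Rightarrow> nat) \<Rightarrow> (('n \<Rightarrow> nat) \<Rightarrow> real) \<Rightarrow> (real ^ 'n) measure" where
  "invariant_measure m \<tau> = (THE \<mu>. \<mu> \<in> cube_probs \<and> markov_operator m \<tau> \<mu> = \<mu>)"

text \<open>Below, \<open>i j0\<close> is irrelevant because it is overwritten by \<open>l\<close>.\<close>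

definition uniformity_condition ::
    "('n::finite \<Rightarrow> nat) \<Rightarrow> (('n \<Rightarrow> nat) \<Rightarrow> real) \<Rightarrow> 'n \<Rightarrow> bool" where
  "uniformity_condition m \<tau> j0 \<longleftrightarrow>
     (\<forall>i. (\<forall>j. j \<noteq> j0 \<longrightarrow> i j \<in> {1..m j}) \<longrightarrow>
        (\<Sum>l=1..m j0. \<tau> (i(j0 := l))) = (\<Prod>j\<in>- {j0}. measure unit_lebesgue (cell m \<tau> j (i j))))"

definition uniform_matrices :: "nat \<Rightarrow> (('n::finite \<Rightarrow> nat) \<Rightarrow> real) set" where
  "uniform_matrices N =
     {\<tau> \<in> gen_transformation_matrices (\<lambda>_. N).
        (\<forall>j. \<forall>k\<in>{1..N}. cell (\<lambda>_. N) \<tau> j k = {(real k - 1) / real N..real k / real N}) \<and>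
        (\<forall>j0. uniformity_condition (\<lambda>_. N) \<tau> j0)}"

definition mod_matrix :: "nat \<Rightarrow> ('n::finite \<Rightarrow> nat) \<Rightarrow> real" where
  "mod_matrix N i =
     (if i \<in> multi_indices (\<lambda>_. N) \<and> N dvd (\<Sum>j\<in>UNIV. i j - 1)
      then 1 / real N ^ (CARD('n) - 1) else 0)"

definition self_similar :: "(real ^ 'n) set \<Rightarrow> bool" where
  "self_similar Z \<longleftrightarrow> Z \<noteq> {} \<and> compact Z \<and>
     (\<exists>(m::nat) (g :: nat \<Rightarrow> real ^ 'n \<Rightarrow> real ^ 'n) (c :: nat \<Rightarrow> real).
        m \<ge> 2 \<and>
        (\<forall>i\<in>{1..m}. 0 < c i \<and> c i < 1 \<and> (\<forall>x y. dist (g i x) (g i y) = c i * dist x y)) \<and>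
        Z = (\<Union>i\<in>{1..m}. g i ` Z))"

text \<open>
  The \<open>s\<close>-th power of the diameter with the conventions of geometric measure theory: the empty set
  contributes \<open>0\<close>, and nonempty sets contribute \<open>1\<close> if \<open>s = 0\<close> (whereas \<open>0 powr 0 = 0\<close>).
\<close>

definition diam_pow :: "real \<Rightarrow> 'a::metric_space set \<Rightarrow> ennreal" where
  "diam_pow s C = (if C = {} then 0 else if s = 0 then 1 else ennreal (diameter C powr s))"

text \<open>Boundedness is required since \<^const>\<open>diameter\<close> is unspecified on unbounded sets.\<close>

definition hausdorff_content :: "real \<Rightarrow> real \<Rightarrow> 'a::metric_space set \<Rightarrow> ennreal" where
  "hausdorff_content s \<delta> A =
     (INF C \<in> {C :: nat \<Rightarrow> 'a set. A \<subseteq> (\<Union>n. C n) \<and> (\<forall>n. bounded (C n) \<and> diameter (C n) \<le> \<delta>)}.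
        \<Sum>n. diam_pow s (C n))"

definition hausdorff_measure :: "real \<Rightarrow> 'a::metric_space set \<Rightarrow> ennreal" where
  "hausdorff_measure s A = (SUP \<delta>\<in>{0<..}. hausdorff_content s \<delta> A)"

definition hausdorff_dimension :: "'a::metric_space set \<Rightarrow> ennreal" where
  "hausdorff_dimension A = Inf {ennreal s | s. s \<ge> 0 \<and> hausdorff_measure s A = 0}"

end

theory Submission
  imports Defs
begin

text \<open>
  Write \<open>S\<close> for the set of digit vectors whose entries, counted from \<open>0\<close>, have a sum divisible
  by \<open>N\<close>.  A vector in \<open>S\<close> is determined by any \<open>d - 1\<close> of its entries, and those can be chosen
  freely (\<open>unique_completion\<close>, \<open>bij_betw_delete_coordinate\<close>); this gives \<open>card S = N ^ (d - 1)\<close>, uniform marginals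
  of \<open>\<tau>\<close> and the uniformity condition.

  The invariant measure has an explicit description.  Fix a coordinate \<open>j0\<close>.  For a point \<open>u\<close> of the
  face \<open>[0,1]^(d-1)\<close> let \<open>h u\<close> be the number whose \<open>k\<close>-th digit in base \<open>N\<close> makes the \<open>k\<close>-th digits of
  all \<open>d\<close> coordinates sum to \<open>0\<close> modulo \<open>N\<close>.  Let \<open>u\<close> be uniformly distributed.  Then the law of the
  point with coordinates \<open>u\<close> and \<open>h u\<close> is a fixed point of the Markov operator: prefixing the digits
  \<open>i \<in> S\<close> to a point of the graph of \<open>h\<close> gives a point of the graph again
  (\<open>completion_graph_grid_shift\<close>), and since \<open>S\<close> projects bijectively onto all digit vectors of the
  face, the law of \<open>u\<close> is reproduced as well (\<open>PiM_unit_lebesgue_self_similar\<close>).  The operator has only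
  one fixed point because its maps contract (\<open>ifs_invariant_measure_unique\<close>).  So one and the same
  measure lives on the graph over each of the \<open>d\<close> faces and projects to Lebesgue measure on each of
  them, which is (P1) and (P3).

  The support \<open>K\<close> is the union of its \<open>N ^ (d - 1)\<close> copies under the maps of ratio \<open>1 / N\<close>, by the fixed
  point equation.  Hence \<open>vol K \<le> N ^ (d - 1) * (1 / N) ^ d * vol K = vol K / N\<close>, so \<open>K\<close> is Lebesgue null
  while it carries the whole invariant measure: this is singularity.  Iterating the decomposition
  covers \<open>K\<close> by \<open>N ^ (n * (d - 1))\<close> sets of diameter \<open>O(N ^ (-n))\<close>, so the dimension is at most \<open>d - 1\<close>.
  Conversely a set of diameter \<open>r\<close> projects into a cube of side \<open>2 * r\<close> in a face, so it has invariant
  measure at most \<open>(2 * r) ^ (d - 1)\<close>, and the mass distribution principle bounds the dimension from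
  below.
\<close>

section \<open>Digit vectors with sum zero modulo \<open>N\<close>\<close>

lemma unique_completing_digit:
  fixes r N :: nat
  assumes "N \<ge> 1"
  shows "\<exists>!l. l \<in> {1..N} \<and> N dvd (l - 1) + r"
proof -
  define q where "q = (N - r mod N) mod N"
  have qN: "q < N" using assms by (simp add: q_def)
  have "(q + r) mod N = ((N - r mod N) + r mod N) mod N"
    unfolding q_def by (simp add: mod_simps)
  also have "\<dots> = 0" using assms by simp
  finally have "N dvd q + r" by auto
  then have ex: "Suc q \<in> {1..N} \<and> N dvd (Suc q - 1) + r" using qN by simp
  have "l = l'" if l: "l \<in> {1..N}" "N dvd (l - 1) + r"
    and l': "l' \<in> {1..N}" "N dvd (l' - 1) + r" for l l'
  proof -
    have "int N dvd (int (l - 1) + int r) - (int (l' - 1) + int r)"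
      using l(2) l'(2) by (intro dvd_diff) (metis int_dvd_int_iff of_nat_add)+
    then have "int N dvd int (l - 1) - int (l' - 1)" by simp
    moreover have "\<bar>int (l - 1) - int (l' - 1)\<bar> < int N" using l(1) l'(1) by auto
    ultimately have "int (l - 1) - int (l' - 1) = 0" 
      using dvd_imp_le_int[of "int (l - 1) - int (l' - 1)" "int N"] by (meson abs_ge_self le_less_trans not_less)
    then have "l - 1 = l' - 1" by simp
    then show ?thesis using l(1) l'(1) by auto
  qed
  with ex show ?thesis by blast
qed

definition zero_sum_indices :: "nat \<Rightarrow> ('n::finite \<Rightarrow> nat) set" where
  "zero_sum_indices N = {i \<in> multi_indices (\<lambda>_. N). N dvd (\<Sum>j\<in>UNIV. i j - 1)}"

lemma multi_indices_eq_PiE: "multi_indices m = (\<Pi>\<^sub>E j\<in>UNIV. {1..m j})"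
  by (auto simp: multi_indices_def PiE_UNIV_domain)

lemma finite_multi_indices: "finite (multi_indices (m :: 'n::finite \<Rightarrow> nat))"
  by (simp add: multi_indices_eq_PiE finite_PiE)

lemma finite_zero_sum_indices: "finite (zero_sum_indices N :: ('n::finite \<Rightarrow> nat) set)"
  unfolding zero_sum_indices_def by (rule finite_subset[OF _ finite_multi_indices]) auto

lemma mod_matrix_eq:
  fixes i :: "'n::finite \<Rightarrow> nat"
  shows "mod_matrix N i = (if i \<in> zero_sum_indices N then 1 / real N ^ (CARD('n) - 1) else 0)"
  by (simp add: mod_matrix_def zero_sum_indices_def)

lemma mass_support_mod_matrix:
  assumes "N \<ge> 1"
  shows "mass_support (mod_matrix N) = zero_sum_indices N"
  using assms by (auto simp: mass_support_def mod_matrix_eq)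

lemma digit_sum_upd:
  fixes i :: "'n::finite \<Rightarrow> nat"
  shows "(\<Sum>j\<in>UNIV. (i(j0 := l)) j - 1) = (l - 1) + (\<Sum>j\<in>-{j0}. i j - 1)"
proof -
  have "(\<Sum>j\<in>UNIV. (i(j0 := l)) j - 1) = (l - 1) + (\<Sum>j\<in>UNIV - {j0}. (i(j0 := l)) j - 1)"
    by (subst sum.remove[of UNIV j0]) auto
  also have "(\<Sum>j\<in>UNIV - {j0}. (i(j0 := l)) j - 1) = (\<Sum>j\<in>-{j0}. i j - 1)"
    by (intro sum.cong) auto
  finally show ?thesis .
qed

lemma unique_completion:
  fixes i :: "'n::finite \<Rightarrow> nat"
  assumes "N \<ge> 1" and "\<And>j. j \<noteq> j0 \<Longrightarrow> i j \<in> {1..N}"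
  shows "\<exists>!l. l \<in> {1..N} \<and> i(j0 := l) \<in> zero_sum_indices N"
proof -
  have "i(j0 := l) \<in> zero_sum_indices N \<longleftrightarrow> N dvd (l - 1) + (\<Sum>j\<in>-{j0}. i j - 1)"
    if "l \<in> {1..N}" for l
  proof -
    have "i(j0 := l) \<in> multi_indices (\<lambda>_. N)"
      using that assms(2) by (auto simp: multi_indices_def)
    then show ?thesis
      unfolding zero_sum_indices_def mem_Collect_eq digit_sum_upd by simp
  qed
  then show ?thesis using unique_completing_digit[OF assms(1)] by metis
qed

text \<open>
  The deleted digit can be recovered from the congruence, and the remaining digits are unrestricted.
\<close>

lemma bij_betw_delete_coordinate:
  fixes j0 :: "'n::finite"
  assumes "N \<ge> 1"
  shows "bij_betw (\<lambda>i. restrict i (-{j0})) (zero_sum_indices N) (\<Pi>\<^sub>E j\<in>-{j0}. {1..N})"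
  unfolding bij_betw_def
proof
  show "inj_on (\<lambda>i. restrict i (-{j0})) (zero_sum_indices N)"
  proof (rule inj_onI)
    fix i i' :: "'n \<Rightarrow> nat"
    assume i: "i \<in> zero_sum_indices N" and i': "i' \<in> zero_sum_indices N"
      and eq: "restrict i (-{j0}) = restrict i' (-{j0})"
    have off: "i j = i' j" if "j \<noteq> j0" for j
      using fun_cong[OF eq, of j] that by simp
    then have "i' = i(j0 := i' j0)" by auto
    moreover have "\<And>j. i j \<in> {1..N}" "\<And>j. i' j \<in> {1..N}"
      using i i' by (auto simp: zero_sum_indices_def multi_indices_def)
    ultimately have "i j0 = i' j0"
      using unique_completion[OF assms, of j0 i] i i' by (metis fun_upd_triv)
    then show "i = i'" using off by (metis ext)
  qed
  show "(\<lambda>i. restrict i (-{j0})) ` zero_sum_indices N = (\<Pi>\<^sub>E j\<in>-{j0}. {1..N})"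
  proof (intro equalityI subsetI)
    fix e assume "e \<in> (\<lambda>i. restrict i (-{j0})) ` zero_sum_indices N"
    then show "e \<in> (\<Pi>\<^sub>E j\<in>-{j0}. {1..N})"
      unfolding zero_sum_indices_def multi_indices_def
      by (auto intro!: restrict_PiE_iff[THEN iffD2])
  next
    fix e assume e: "e \<in> (\<Pi>\<^sub>E j\<in>-{j0}. {1..N})"
    then have "\<And>j. j \<noteq> j0 \<Longrightarrow> e j \<in> {1..N}" by (auto simp: PiE_iff)
    then obtain l where "e(j0 := l) \<in> zero_sum_indices N"
      using unique_completion[OF assms, of j0 e] by blast
    moreover have "restrict (e(j0 := l)) (-{j0}) = e"
      using e by (auto simp: fun_eq_iff PiE_iff extensional_def)
    ultimately show "e \<in> (\<lambda>i. restrict i (-{j0})) ` zero_sum_indices N"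
      by (metis (no_types, lifting) image_eqI)
  qed
qed

lemma card_compl_singleton: "card (-{j0 :: 'n::finite}) = CARD('n) - 1"
  by (simp add: Compl_eq_Diff_UNIV card_Diff_singleton)

lemma card_zero_sum_indices:
  assumes "N \<ge> 1"
  shows "card (zero_sum_indices N :: ('n::finite \<Rightarrow> nat) set) = N ^ (CARD('n) - 1)"
  using bij_betw_same_card[OF bij_betw_delete_coordinate[OF assms, of "undefined :: 'n"]]
  by (simp add: card_PiE card_compl_singleton)

lemma ex_other_index:
  assumes "CARD('n::finite) \<ge> 2"
  shows "\<exists>j0. j0 \<noteq> (j :: 'n)"
proof (rule ccontr)
  assume "\<not> ?thesis"
  then have "UNIV = {j}" by auto
  then have "CARD('n) = card {j}" by simp
  then show False using assms by simp
qed

text \<open>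
  With a second coordinate \<open>j0\<close> deleted, fixing the digit at \<open>j\<close> becomes a restriction on one factor
  of a full product.  This needs \<open>d \<ge> 2\<close>.
\<close>

lemma card_zero_sum_slice:
  fixes j :: "'n::finite"
  assumes "N \<ge> 1" "CARD('n) \<ge> 2" "k \<in> {1..N}"
  shows "card {i \<in> zero_sum_indices N. i j = k} = N ^ (CARD('n) - 2)"
proof -
  obtain j0 where j0: "j0 \<noteq> j" using ex_other_index[OF assms(2)] by blast
  let ?F = "\<lambda>x. if x = j then {k} else {1..N}"
  have bij: "bij_betw (\<lambda>i. restrict i (-{j0})) {i \<in> zero_sum_indices N. i j = k} (\<Pi>\<^sub>E x\<in>-{j0}. ?F x)"
  proof (rule bij_betw_subset[OF bij_betw_delete_coordinate[OF assms(1), of j0]])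
    have "(\<lambda>i. restrict i (-{j0})) ` {i \<in> zero_sum_indices N. i j = k}
        = {e \<in> (\<lambda>i. restrict i (-{j0})) ` zero_sum_indices N. e j = k}"
      using j0 by auto
    also have "\<dots> = {e \<in> (\<Pi>\<^sub>E x\<in>-{j0}. {1..N}). e j = k}"
      using bij_betw_delete_coordinate[OF assms(1), of j0] by (simp add: bij_betw_def)
    also have "\<dots> = (\<Pi>\<^sub>E x\<in>-{j0}. ?F x)"
    proof (intro equalityI subsetI)
      fix e assume "e \<in> {e \<in> (\<Pi>\<^sub>E x\<in>-{j0}. {1..N}). e j = k}"
      then show "e \<in> (\<Pi>\<^sub>E x\<in>-{j0}. ?F x)" by (auto simp: PiE_iff)
    next
      fix e assume e: "e \<in> (\<Pi>\<^sub>E x\<in>-{j0}. ?F x)"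
      then have "e x \<in> ?F x" if "x \<noteq> j0" for x using that by (simp add: PiE_iff)
      then have "e x \<in> {1..N}" "e j = k" if "x \<noteq> j0" for x
        using that j0 assms(3) by (metis singletonD)+
      moreover from this(2)[of j] j0 have "e j = k" by auto
      ultimately show "e \<in> {e \<in> (\<Pi>\<^sub>E x\<in>-{j0}. {1..N}). e j = k}"
        using e by (simp add: PiE_iff)
    qed
    finally show "(\<lambda>i. restrict i (-{j0})) ` {i \<in> zero_sum_indices N. i j = k} = (\<Pi>\<^sub>E x\<in>-{j0}. ?F x)" .
  qed auto
  have "card {i \<in> zero_sum_indices N. i j = k} = (\<Prod>x\<in>-{j0}. card (?F x))"
    using bij_betw_same_card[OF bij] by (simp add: card_PiE)
  also have "\<dots> = card (?F j) * (\<Prod>x\<in>-{j0}-{j}. card (?F x))"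
    using j0 by (intro prod.remove) auto
  also have "(\<Prod>x\<in>-{j0}-{j}. card (?F x)) = (\<Prod>x\<in>-{j0}-{j}. N)"
    by (intro prod.cong) auto
  also have "\<dots> = N ^ (CARD('n) - 2)"
    using j0 by (simp add: card_compl_singleton card_Diff_singleton numeral_2_eq_2)
  finally show ?thesis by simp
qed

lemma sum_mod_matrix:
  fixes A :: "('n::finite \<Rightarrow> nat) set"
  assumes "finite A"
  shows "(\<Sum>i\<in>A. mod_matrix N i) = real (card (A \<inter> zero_sum_indices N)) / real N ^ (CARD('n) - 1)"
  using assms by (simp add: mod_matrix_eq sum.If_cases Int_def)

lemma mod_matrix_marginal:
  fixes j :: "'n::finite"
  assumes "N \<ge> 1" "CARD('n) \<ge> 2" "k \<in> {1..N}"
  shows "(\<Sum>i\<in>{i \<in> multi_indices (\<lambda>_. N). i j = k}. mod_matrix N i) = 1 / real N"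
proof -
  have "{i \<in> multi_indices (\<lambda>_. N). i j = k} \<inter> zero_sum_indices N = {i \<in> zero_sum_indices N. i j = k}"
    by (auto simp: zero_sum_indices_def)
  moreover have "finite {i \<in> multi_indices (\<lambda>_. N). i j = k}"
    by (rule finite_subset[OF _ finite_multi_indices]) auto
  ultimately have "(\<Sum>i\<in>{i \<in> multi_indices (\<lambda>_. N). i j = k}. mod_matrix N i)
      = real (N ^ (CARD('n) - 2)) / real N ^ (CARD('n) - 1)"
    by (simp add: sum_mod_matrix card_zero_sum_slice[OF assms])
  also have "CARD('n) - 1 = Suc (CARD('n) - 2)" using assms(2) by simp
  finally show ?thesis using assms(1) by simp
qed

lemma cut_mod_matrix:
  fixes j :: "'n::finite"
  assumes "N \<ge> 1" "CARD('n) \<ge> 2" "k \<le> N"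
  shows "cut (\<lambda>_. N) (mod_matrix N) j k = real k / real N"
  using assms(3)
proof (induction k)
  case 0
  have "i j \<ge> 1" if "i \<in> multi_indices (\<lambda>_. N)" for i
    using that by (simp add: multi_indices_def)
  then have empty: "{i \<in> multi_indices (\<lambda>_. N). i j \<le> 0} = {}" by fastforce
  show ?case unfolding cut_def empty by simp
next
  case (Suc k)
  have "{i \<in> multi_indices (\<lambda>_. N). i j \<le> Suc k} =
      {i \<in> multi_indices (\<lambda>_. N). i j \<le> k} \<union> {i \<in> multi_indices (\<lambda>_. N). i j = Suc k}"
    by auto
  then have "cut (\<lambda>_. N) (mod_matrix N) j (Suc k) = cut (\<lambda>_. N) (mod_matrix N) j k +
      (\<Sum>i\<in>{i \<in> multi_indices (\<lambda>_. N). i j = Suc k}. mod_matrix N i)"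
    unfolding cut_def
    by (simp only:) (subst sum.union_disjoint, auto intro: finite_subset[OF _ finite_multi_indices[of "\<lambda>_. N"]])
  then show ?case
    using Suc mod_matrix_marginal[OF assms(1,2), of "Suc k" j] assms(1)
    by (simp add: add_divide_distrib)
qed

lemma cell_mod_matrix:
  fixes j :: "'n::finite"
  assumes "N \<ge> 1" "CARD('n) \<ge> 2" "k \<in> {1..N}"
  shows "cell (\<lambda>_. N) (mod_matrix N) j k = {(real k - 1) / real N..real k / real N}"
  
proof -
  have "k - 1 \<le> N" "k \<le> N" "real (k - 1) = real k - 1" using assms(3) by auto
  then show ?thesis
    unfolding cell_def by (simp only: cut_mod_matrix[OF assms(1,2)])
qed

lemma measure_unit_lebesgue_Icc:
  assumes "0 \<le> a" "a \<le> b" "b \<le> 1"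
  shows "measure unit_lebesgue {a..b} = b - a"
  using assms unfolding unit_lebesgue_def
  by (subst measure_restrict_space) auto

lemma uniformity_condition_mod_matrix:
  fixes j0 :: "'n::finite"
  assumes "N \<ge> 1" "CARD('n) \<ge> 2"
  shows "uniformity_condition (\<lambda>_. N) (mod_matrix N) j0"
  unfolding uniformity_condition_def
proof (intro allI impI)
  fix i :: "'n \<Rightarrow> nat"
  assume i: "\<forall>j. j \<noteq> j0 \<longrightarrow> i j \<in> {1..N}"
  then have "\<exists>!l. l \<in> {1..N} \<and> i(j0 := l) \<in> zero_sum_indices N"
    by (intro unique_completion[OF assms(1)]) blast
  then obtain l0 where l0: "l0 \<in> {1..N} \<and> i(j0 := l0) \<in> zero_sum_indices N"
    and uni: "\<forall>l. l \<in> {1..N} \<and> i(j0 := l) \<in> zero_sum_indices N \<longrightarrow> l = l0"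
    by (rule ex1E)
  have "(\<Sum>l=1..N. mod_matrix N (i(j0 := l))) =
      (\<Sum>l\<in>{1..N}. if l = l0 then 1 / real N ^ (CARD('n) - 1) else 0)"
  proof (rule sum.cong[OF refl])
    fix l assume "l \<in> {1..N}"
    then have "i(j0 := l) \<in> zero_sum_indices N \<longleftrightarrow> l = l0" using l0 uni by blast
    then show "mod_matrix N (i(j0 := l)) = (if l = l0 then 1 / real N ^ (CARD('n) - 1) else 0)"
      by (simp only: mod_matrix_eq)
  qed
  also have "\<dots> = (1 / real N) ^ card (-{j0})"
    using l0 by (simp add: card_compl_singleton power_divide)
  also have "\<dots> = (\<Prod>j\<in>-{j0}. measure unit_lebesgue (cell (\<lambda>_. N) (mod_matrix N) j (i j)))"
  proof -
    have "measure unit_lebesgue (cell (\<lambda>_. N) (mod_matrix N) j (i j)) = 1 / real N" if "j \<noteq> j0" for j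
    proof -
      have ij: "i j \<in> {1..N}" using i that by auto
      have "measure unit_lebesgue (cell (\<lambda>_. N) (mod_matrix N) j (i j))
          = real (i j) / real N - (real (i j) - 1) / real N"
        using ij assms unfolding cell_mod_matrix[OF assms ij]
        by (intro measure_unit_lebesgue_Icc) (auto intro!: divide_right_mono)
      also have "\<dots> = 1 / real N"
        by (simp add: diff_divide_distrib)
      finally show ?thesis .
    qed
    then show ?thesis by simp
  qed
  finally show "(\<Sum>l=1..N. mod_matrix N (i(j0 := l))) =
      (\<Prod>j\<in>-{j0}. measure unit_lebesgue (cell (\<lambda>_. N) (mod_matrix N) j (i j)))" .
qed

lemma mod_matrix_uniform:
  assumes "CARD('n) \<ge> 2" "N \<ge> 2"
  shows "(mod_matrix N :: ('n::finite \<Rightarrow> nat) \<Rightarrow> real) \<in> uniform_matrices N"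
proof -
  have N: "N \<ge> 1" using assms by simp
  have "(\<Sum>i\<in>multi_indices (\<lambda>_. N). mod_matrix N (i :: 'n \<Rightarrow> nat)) = 1"
  proof -
    have "multi_indices (\<lambda>_. N) \<inter> zero_sum_indices N = (zero_sum_indices N :: ('n \<Rightarrow> nat) set)"
      by (auto simp: zero_sum_indices_def)
    then show ?thesis using N
      by (simp add: sum_mod_matrix finite_multi_indices card_zero_sum_indices)
  qed
  then have "(mod_matrix N :: ('n \<Rightarrow> nat) \<Rightarrow> real) \<in> gen_transformation_matrices (\<lambda>_. N)"
    using assms N mod_matrix_marginal[OF N assms(1)]
    by (auto simp: gen_transformation_matrices_def mod_matrix_def)
  then show ?thesis
    using uniformity_condition_mod_matrix[OF N assms(1)] cell_mod_matrix[OF N assms(1)]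
    by (auto simp: uniform_matrices_def)
qed

section \<open>Uniqueness of invariant measures of contracting systems\<close>

text \<open>
  Both the Markov operator and the mixture of shifted product measures below are given by
  \<open>measure_of\<close>, whose value is only meaningful once the set function is known to be countably additive.
\<close>

lemma emeasure_mixture:
  assumes "finite I" and "\<And>i. i \<in> I \<Longrightarrow> sets (M i) = sets B" and "A \<in> sets B"
  shows "emeasure (measure_of (space B) (sets B) (\<lambda>A. \<Sum>i\<in>I. w i * emeasure (M i) A)) A =
      (\<Sum>i\<in>I. w i * emeasure (M i) A)"
proof (rule emeasure_measure_of[OF refl sets.space_closed])
  show "A \<in> sets (measure_of (space B) (sets B) (\<lambda>A. \<Sum>i\<in>I. w i * emeasure (M i) A))"
    using assms(3) by simp
  show "positive (sets (measure_of (space B) (sets B) (\<lambda>A. \<Sum>i\<in>I. w i * emeasure (M i) A)))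
      (\<lambda>A. \<Sum>i\<in>I. w i * emeasure (M i) A)"
    by (simp add: positive_def)
  show "countably_additive (sets (measure_of (space B) (sets B) (\<lambda>A. \<Sum>i\<in>I. w i * emeasure (M i) A)))
      (\<lambda>A. \<Sum>i\<in>I. w i * emeasure (M i) A)"
  proof (rule countably_additiveI)
    fix F :: "nat \<Rightarrow> 'b set"
    assume "range F \<subseteq> sets (measure_of (space B) (sets B) (\<lambda>A. \<Sum>i\<in>I. w i * emeasure (M i) A))"
      and disj: "disjoint_family F"
    then have F: "range F \<subseteq> sets B" by simp
    have "(\<Sum>n. \<Sum>i\<in>I. w i * emeasure (M i) (F n)) = (\<Sum>i\<in>I. \<Sum>n. w i * emeasure (M i) (F n))"
      by (rule suminf_sum) simp
    also have "\<dots> = (\<Sum>i\<in>I. w i * emeasure (M i) (\<Union>n. F n))"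
      using F disj assms(2) by (intro sum.cong refl) (simp add: suminf_emeasure)
    finally show "(\<Sum>n. \<Sum>i\<in>I. w i * emeasure (M i) (F n)) = (\<Sum>i\<in>I. w i * emeasure (M i) (\<Union>n. F n))" .
  qed
qed

text \<open>
  Closed sets form an intersection-stable generator of the Borel sets; both measures are pushed to
  the whole space, where this generator is available.
\<close>

lemma borel_prob_eqI_closed:
  fixes X :: "'a::topological_space set"
  assumes X: "X \<in> sets borel"
    and fin: "finite_measure \<mu>"
    and \<mu>: "sets \<mu> = sets (restrict_space borel X)" and \<nu>: "sets \<nu> = sets (restrict_space borel X)"
    and closed: "\<And>C. closed C \<Longrightarrow> emeasure \<mu> (C \<inter> X) = emeasure \<nu> (C \<inter> X)"
  shows "\<mu> = \<nu>"
proof -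
  interpret finite_measure \<mu> by fact
  have [simp]: "space \<mu> = X" "space \<nu> = X"
    using sets_eq_imp_space_eq[OF \<mu>] sets_eq_imp_space_eq[OF \<nu>] by (simp_all add: space_restrict_space)
  have id_meas: "(\<lambda>x. x) \<in> measurable \<mu> borel" "(\<lambda>x. x) \<in> measurable \<nu> borel"
    unfolding measurable_cong_sets[OF \<mu> refl] measurable_cong_sets[OF \<nu> refl]
    by (auto intro: measurable_restrict_space1)
  have "distr \<mu> borel (\<lambda>x. x) = distr \<nu> borel (\<lambda>x. x)"
  proof (rule measure_eqI_generator_eq[where E = "Collect closed" and \<Omega> = UNIV and A = "\<lambda>_. UNIV"])
    show "emeasure (distr \<mu> borel (\<lambda>x. x)) C = emeasure (distr \<nu> borel (\<lambda>x. x)) C"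
      if "C \<in> Collect closed" for C
      using that closed[of C] id_meas by (simp add: emeasure_distr borel_closed)
    show "emeasure (distr \<mu> borel (\<lambda>x. x)) UNIV \<noteq> \<infinity>"
      using id_meas by (simp add: emeasure_distr)
    show "sets (distr \<mu> borel (\<lambda>x. x)) = sigma_sets UNIV (Collect closed)"
      by (simp add: borel_eq_closed)
    show "sets (distr \<nu> borel (\<lambda>x. x)) = sigma_sets UNIV (Collect closed)"
      by (simp add: borel_eq_closed)
  qed (auto simp: Int_stable_def)
  then have *: "emeasure \<mu> (A \<inter> X) = emeasure \<nu> (A \<inter> X)" if "A \<in> sets borel" for A
    using that id_meas by (metis emeasure_distr vimage_ident \<open>space \<mu> = X\<close> \<open>space \<nu> = X\<close>)
  show ?thesis
  proof (rule measure_eqI)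
    show "sets \<mu> = sets \<nu>" using \<mu> \<nu> by simp
    fix A assume "A \<in> sets \<mu>"
    then have "A \<in> sets borel" "A \<inter> X = A"
      using X unfolding \<mu> by (auto simp: sets_restrict_space)
    then show "emeasure \<mu> A = emeasure \<nu> A" using *[of A] by simp
  qed
qed

text \<open>
  Two invariant measures can be compared directly, without test functions.  If \<open>n\<close> levels of the
  system bring points together up to \<open>D * c ^ n\<close>, then each image of \<open>X\<close> at level \<open>n\<close> that meets \<open>A\<close> lies in
  the \<open>D * c ^ n\<close>-thickening of \<open>A\<close>, so the weight that \<open>\<mu>\<close> gives to \<open>A\<close> is bounded by the weight that \<open>\<nu>\<close>
  gives to the thickening.  The induction peels off one level at a time.
\<close>

lemma ifs_invariant_measure_mono_thickening:
  fixes X :: "'a::metric_space set" and f :: "'i \<Rightarrow> 'a \<Rightarrow> 'a" and p :: "'i \<Rightarrow> ennreal"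
  assumes f: "\<And>i. i \<in> I \<Longrightarrow> f i \<in> measurable (restrict_space borel X) (restrict_space borel X)"
    and lip: "\<And>i x y. i \<in> I \<Longrightarrow> x \<in> X \<Longrightarrow> y \<in> X \<Longrightarrow> dist (f i x) (f i y) \<le> c * dist x y"
    and c: "0 \<le> c" and D: "\<And>x y. x \<in> X \<Longrightarrow> y \<in> X \<Longrightarrow> dist x y \<le> D"
    and \<mu>: "prob_space \<mu>" "sets \<mu> = sets (restrict_space borel X)"
    and \<nu>: "prob_space \<nu>" "sets \<nu> = sets (restrict_space borel X)"
    and inv_\<mu>: "\<And>A. A \<in> sets \<mu> \<Longrightarrow> emeasure \<mu> A = (\<Sum>i\<in>I. p i * emeasure \<mu> (f i -` A \<inter> X))"
    and inv_\<nu>: "\<And>A. A \<in> sets \<nu> \<Longrightarrow> emeasure \<nu> A = (\<Sum>i\<in>I. p i * emeasure \<nu> (f i -` A \<inter> X))"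
    and A: "A \<in> sets \<mu>" and B: "B \<in> sets \<nu>"
    and near: "\<And>x y. x \<in> A \<Longrightarrow> y \<in> X \<Longrightarrow> dist x y \<le> D * c ^ n \<Longrightarrow> y \<in> B"
  shows "emeasure \<mu> A \<le> emeasure \<nu> B"
  using A B near
proof (induction n arbitrary: A B)
  case 0
  have sp: "space \<mu> = X" "space \<nu> = X"
    using sets_eq_imp_space_eq[OF \<mu>(2)] sets_eq_imp_space_eq[OF \<nu>(2)] by (simp_all add: space_restrict_space)
  show ?case
  proof (cases "A = {}")
    case False
    then obtain x where x: "x \<in> A" by blast
    have "X \<subseteq> B"
    proof
      fix y assume y: "y \<in> X"
      have "x \<in> X" using x sets.sets_into_space[OF 0(1)] sp by blast
      then show "y \<in> B" using 0(3)[OF x y] D y by simp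
    qed
    then have "B = space \<nu>" using sets.sets_into_space[OF 0(2)] sp by blast
    then show ?thesis
      using prob_space.emeasure_space_1[OF \<nu>(1)] prob_space.emeasure_le_1[OF \<mu>(1)] by simp
  qed simp
next
  case (Suc n)
  have sp: "space \<mu> = X" "space \<nu> = X"
    using sets_eq_imp_space_eq[OF \<mu>(2)] sets_eq_imp_space_eq[OF \<nu>(2)] by (simp_all add: space_restrict_space)
  have "emeasure \<mu> A = (\<Sum>i\<in>I. p i * emeasure \<mu> (f i -` A \<inter> X))"
    using inv_\<mu>[OF Suc.prems(1)] .
  also have "\<dots> \<le> (\<Sum>i\<in>I. p i * emeasure \<nu> (f i -` B \<inter> X))"
  proof (intro sum_mono mult_left_mono Suc.IH)
    fix i assume i: "i \<in> I"
    show "f i -` A \<inter> X \<in> sets \<mu>"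
      using measurable_sets[OF f[OF i]] Suc.prems(1) unfolding \<mu>(2) by (auto simp: space_restrict_space)
    show "f i -` B \<inter> X \<in> sets \<nu>"
      using measurable_sets[OF f[OF i]] Suc.prems(2) unfolding \<nu>(2) by (auto simp: space_restrict_space)
    fix x y assume x: "x \<in> f i -` A \<inter> X" and y: "y \<in> X" and xy: "dist x y \<le> D * c ^ n"
    have "dist (f i x) (f i y) \<le> c * dist x y" using lip i x y by simp
    also have "\<dots> \<le> D * c ^ Suc n" using mult_left_mono[OF xy c] by (simp add: ac_simps)
    finally have "dist (f i x) (f i y) \<le> D * c ^ Suc n" .
    moreover have "f i y \<in> X"
      using measurable_space[OF f[OF i]] y by (simp add: space_restrict_space)
    ultimately show "y \<in> f i -` B \<inter> X" using Suc.prems(3) x y by auto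
  qed simp
  also have "\<dots> = emeasure \<nu> B"
    using inv_\<nu>[OF Suc.prems(2)] by simp
  finally show ?case .
qed

lemma emeasure_thickening_tendsto:
  fixes X :: "'a::metric_space set"
  assumes \<nu>: "finite_measure \<nu>" "sets \<nu> = sets (restrict_space borel X)"
    and C: "closed C" "C \<noteq> {}" and e: "decseq e" "e \<longlonglongrightarrow> 0"
  shows "(\<lambda>n. emeasure \<nu> {y \<in> X. infdist y C \<le> e n}) \<longlonglongrightarrow> emeasure \<nu> (C \<inter> X)"
    and "{y \<in> X. infdist y C \<le> r} \<in> sets \<nu>"
proof -
  interpret finite_measure \<nu> by fact
  have meas: "{y \<in> X. infdist y C \<le> r} \<in> sets \<nu>" for r
  proof -
    have "closed {y. infdist y C \<le> r}"
      by (intro closed_Collect_le continuous_intros)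
    then have "X \<inter> {y. infdist y C \<le> r} \<in> sets (restrict_space borel X)"
      unfolding sets_restrict_space by (intro imageI borel_closed)
    moreover have "X \<inter> {y. infdist y C \<le> r} = {y \<in> X. infdist y C \<le> r}" by auto
    ultimately show ?thesis unfolding \<nu>(2) by simp
  qed
  then show "{y \<in> X. infdist y C \<le> r} \<in> sets \<nu>" .
  have "(\<Inter>n. {y \<in> X. infdist y C \<le> e n}) = C \<inter> X"
  proof (intro equalityI subsetI)
    fix y assume y: "y \<in> (\<Inter>n. {y \<in> X. infdist y C \<le> e n})"
    then have yX: "y \<in> X" and ye: "infdist y C \<le> e n" for n by simp_all
    have "infdist y C \<le> 0"
      by (rule LIMSEQ_le_const[OF e(2)]) (use ye in blast)
    then have "infdist y C = 0" using infdist_nonneg[of y C] by linarith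
    then show "y \<in> C \<inter> X" using yX in_closed_iff_infdist_zero[OF C] by simp
  next
    fix y assume "y \<in> C \<inter> X"
    then show "y \<in> (\<Inter>n. {y \<in> X. infdist y C \<le> e n})"
      using decseq_ge[OF e] by auto
  qed
  moreover have "decseq (\<lambda>n. {y \<in> X. infdist y C \<le> e n})"
    using e(1) by (auto simp: decseq_def intro: order_trans)
  ultimately show "(\<lambda>n. emeasure \<nu> {y \<in> X. infdist y C \<le> e n}) \<longlonglongrightarrow> emeasure \<nu> (C \<inter> X)"
    using Lim_emeasure_decseq[of "\<lambda>n. {y \<in> X. infdist y C \<le> e n}" \<nu>] meas emeasure_finite
    by (simp add: image_subset_iff)
qed

text \<open>
  The thickenings of a closed set shrink to that set, so the comparison above gives \<open>\<mu> C \<le> \<nu> C\<close> for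
  closed \<open>C\<close>, and equality by symmetry.
\<close>

lemma ifs_invariant_measure_unique:
  fixes X :: "'a::metric_space set" and f :: "'i \<Rightarrow> 'a \<Rightarrow> 'a" and p :: "'i \<Rightarrow> ennreal"
  assumes X: "X \<in> sets borel" "bounded X"
    and f: "\<And>i. i \<in> I \<Longrightarrow> f i \<in> measurable (restrict_space borel X) (restrict_space borel X)"
    and lip: "\<And>i x y. i \<in> I \<Longrightarrow> x \<in> X \<Longrightarrow> y \<in> X \<Longrightarrow> dist (f i x) (f i y) \<le> c * dist x y"
    and c: "0 \<le> c" "c < 1"
    and \<mu>: "prob_space \<mu>" "sets \<mu> = sets (restrict_space borel X)"
    and \<nu>: "prob_space \<nu>" "sets \<nu> = sets (restrict_space borel X)"
    and inv_\<mu>: "\<And>A. A \<in> sets \<mu> \<Longrightarrow> emeasure \<mu> A = (\<Sum>i\<in>I. p i * emeasure \<mu> (f i -` A \<inter> X))"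
    and inv_\<nu>: "\<And>A. A \<in> sets \<nu> \<Longrightarrow> emeasure \<nu> A = (\<Sum>i\<in>I. p i * emeasure \<nu> (f i -` A \<inter> X))"
  shows "\<mu> = \<nu>"
proof -
  define D where "D = diameter X"
  have D: "dist x y \<le> D" if "x \<in> X" "y \<in> X" for x y
    using diameter_bounded_bound[OF X(2)] that by (simp add: D_def)
  have D0: "0 \<le> D" using diameter_ge_0[OF X(2)] by (simp add: D_def)
  have e: "decseq (\<lambda>n. D * c ^ n)" "(\<lambda>n. D * c ^ n) \<longlonglongrightarrow> 0"
  proof -
    show "decseq (\<lambda>n. D * c ^ n)"
      using c D0 by (auto simp: decseq_def intro!: mult_left_mono power_decreasing)
    show "(\<lambda>n. D * c ^ n) \<longlonglongrightarrow> 0"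
      using c by (intro tendsto_mult_right_zero LIMSEQ_realpow_zero)
  qed
  have le: "emeasure \<mu> (C \<inter> X) \<le> emeasure \<nu> (C \<inter> X)"
    if C: "closed C" and \<mu>: "prob_space \<mu>" "sets \<mu> = sets (restrict_space borel X)"
      and \<nu>: "prob_space \<nu>" "sets \<nu> = sets (restrict_space borel X)"
      and inv_\<mu>: "\<And>A. A \<in> sets \<mu> \<Longrightarrow> emeasure \<mu> A = (\<Sum>i\<in>I. p i * emeasure \<mu> (f i -` A \<inter> X))"
      and inv_\<nu>: "\<And>A. A \<in> sets \<nu> \<Longrightarrow> emeasure \<nu> A = (\<Sum>i\<in>I. p i * emeasure \<nu> (f i -` A \<inter> X))"
    for C and \<mu> \<nu> :: "'a measure"
  proof (cases "C = {}")
    case False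
    have "finite_measure \<nu>" using \<nu>(1) by (simp add: prob_space_def)
    note thick = emeasure_thickening_tendsto[OF this \<nu>(2) C False e]
    show ?thesis
    proof (rule LIMSEQ_le_const[OF thick(1)], intro exI allI impI)
      fix n
      show "emeasure \<mu> (C \<inter> X) \<le> emeasure \<nu> {y \<in> X. infdist y C \<le> D * c ^ n}"
      proof (rule ifs_invariant_measure_mono_thickening[OF f lip c(1) D \<mu> \<nu> inv_\<mu> inv_\<nu> _ thick(2)])
        show "C \<inter> X \<in> sets \<mu>"
          using C unfolding \<mu>(2) sets_restrict_space Int_commute[of C X] by (intro imageI borel_closed)
        fix x y assume "x \<in> C \<inter> X" "y \<in> X" "dist x y \<le> D * c ^ n"
        then show "y \<in> {y \<in> X. infdist y C \<le> D * c ^ n}"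
          using infdist_le2[of x C y "D * c ^ n"] by (simp add: dist_commute)
      qed
    qed
  qed simp
  show ?thesis
  proof (rule borel_prob_eqI_closed[OF X(1) _ \<mu>(2) \<nu>(2)])
    show "finite_measure \<mu>" using \<mu>(1) by (simp add: prob_space_def)
    show "emeasure \<mu> (C \<inter> X) = emeasure \<nu> (C \<inter> X)" if "closed C" for C
      using le[OF that \<mu> \<nu> inv_\<mu> inv_\<nu>] le[OF that \<nu> \<mu> inv_\<nu> inv_\<mu>] by (rule antisym)
  qed
qed

section \<open>The Markov operator on the cube\<close>

text \<open>
  The contraction attached to \<open>i\<close>, for cells of equal length \<open>1 / N\<close>: it puts the digits \<open>i - 1\<close> in front
  of the base \<open>N\<close> expansions of the coordinates.
\<close>

definition grid_map :: "nat \<Rightarrow> ('n::finite \<Rightarrow> nat) \<Rightarrow> real ^ 'n \<Rightarrow> real ^ 'n" where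
  "grid_map N i x = (\<chi> j. (real (i j) - 1 + x $ j) / real N)"

lemma contraction_mod_matrix:
  assumes "N \<ge> 1" "CARD('n::finite) \<ge> 2" "i \<in> multi_indices (\<lambda>_. N)"
  shows "contraction (\<lambda>_. N) (mod_matrix N) (i :: 'n \<Rightarrow> nat) = grid_map N i"
proof (intro ext iffD2[OF vec_eq_iff] allI)
  fix x :: "real ^ 'n" and j :: 'n
  have ij: "1 \<le> i j" "i j \<le> N" using assms(3) by (auto simp: multi_indices_def)
  have "cut (\<lambda>_. N) (mod_matrix N) j (i j - 1) = (real (i j) - 1) / real N"
    using ij cut_mod_matrix[OF assms(1,2), of "i j - 1" j] by (simp add: of_nat_diff)
  moreover have "cut (\<lambda>_. N) (mod_matrix N) j (i j) = real (i j) / real N"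
    using ij cut_mod_matrix[OF assms(1,2)] by simp
  ultimately show "contraction (\<lambda>_. N) (mod_matrix N) i x $ j = grid_map N i x $ j"
    by (simp add: contraction_def grid_map_def add_divide_distrib diff_divide_distrib)
qed

lemma grid_map_eq_affine:
  "grid_map N i x = (1 / real N) *\<^sub>R x + grid_map N i 0"
  by (simp add: vec_eq_iff grid_map_def add_divide_distrib diff_divide_distrib)

lemma dist_grid_map: "dist (grid_map N i x) (grid_map N i y) = 1 / real N * dist x y"
  unfolding grid_map_eq_affine[of N i x] grid_map_eq_affine[of N i y]
  by (simp add: dist_norm scaleR_diff_right[symmetric] del: scaleR_diff_right)

lemma continuous_on_grid_map: "continuous_on A (grid_map N i)"
  unfolding grid_map_def divide_inverse by (intro continuous_intros)

lemma grid_map_in_cube: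
  assumes "i \<in> multi_indices (\<lambda>_. N)" "x \<in> cube"
  shows "grid_map N i x \<in> cube"
proof -
  have "0 \<le> (real (i j) - 1 + x $ j) / real N \<and> (real (i j) - 1 + x $ j) / real N \<le> 1" for j
  proof -
    have *: "0 \<le> x $ j" "x $ j \<le> 1" "1 \<le> i j" "i j \<le> N"
      using assms by (auto simp: cube_def multi_indices_def)
    then have "real (i j) \<ge> 1" "real (i j) \<le> real N" by linarith+
    with * show ?thesis by (auto simp: divide_le_eq)
  qed
  then show ?thesis by (simp add: cube_def grid_map_def)
qed

lemma cube_eq_cbox: "cube = cbox 0 (\<chi> j. 1)"
  by (auto simp: cube_def mem_box_cart)

lemma compact_cube: "compact cube"
  by (simp add: cube_eq_cbox)

lemma cube_in_borel [measurable, simp]: "cube \<in> sets borel"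
  by (simp add: cube_eq_cbox)

lemma space_cube_borel [simp]: "space cube_borel = cube"
  by (simp add: cube_borel_def space_restrict_space)

lemma measurable_grid_map:
  assumes "i \<in> multi_indices (\<lambda>_. N)"
  shows "grid_map N i \<in> measurable cube_borel cube_borel"
  unfolding cube_borel_def
  by (rule measurable_restrict_space3)
    (use assms grid_map_in_cube in \<open>auto intro!: borel_measurable_continuous_onI continuous_on_grid_map\<close>)

lemma cube_probsD:
  assumes "\<mu> \<in> cube_probs"
  shows "prob_space \<mu>" "sets \<mu> = sets cube_borel" "space \<mu> = cube"
  using assms sets_eq_imp_space_eq[of \<mu> cube_borel] by (auto simp: cube_probs_def)

text \<open>
  The form in which the fixed point property is used: an identity between measures of Borel sets,
  with equal weights and the affine grid maps.
\<close>

lemma markov_fixed_iff: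
  fixes \<mu> :: "(real ^ 'n::finite) measure"
  assumes N: "N \<ge> 1" and d: "CARD('n) \<ge> 2" and \<mu>: "\<mu> \<in> cube_probs"
  shows "markov_operator (\<lambda>_. N) (mod_matrix N) \<mu> = \<mu> \<longleftrightarrow>
    (\<forall>A\<in>sets cube_borel. emeasure \<mu> A = (\<Sum>i\<in>zero_sum_indices N.
        ennreal (1 / real N ^ (CARD('n) - 1)) * emeasure \<mu> (grid_map N i -` A \<inter> cube)))"
proof -
  note \<mu>' = cube_probsD[OF \<mu>]
  let ?V = "markov_operator (\<lambda>_. N) (mod_matrix N) \<mu>"
  have V: "?V = measure_of (space cube_borel) (sets cube_borel)
    (\<lambda>A. \<Sum>i\<in>zero_sum_indices N. ennreal (mod_matrix N i) *
       emeasure (distr \<mu> cube_borel (contraction (\<lambda>_. N) (mod_matrix N) i)) A)"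
    unfolding markov_operator_def mass_support_mod_matrix[OF N] by simp
  have sets_V: "sets ?V = sets cube_borel"
    unfolding V by (rule sets.sets_measure_of_eq)
  have em: "emeasure ?V A = (\<Sum>i\<in>zero_sum_indices N.
        ennreal (1 / real N ^ (CARD('n) - 1)) * emeasure \<mu> (grid_map N i -` A \<inter> cube))"
    if A: "A \<in> sets cube_borel" for A
    unfolding V
  proof (subst emeasure_mixture[OF finite_zero_sum_indices _ A], simp, intro sum.cong refl)
    fix i :: "'n \<Rightarrow> nat" assume i: "i \<in> zero_sum_indices N"
    then have im: "i \<in> multi_indices (\<lambda>_. N)" by (simp add: zero_sum_indices_def)
    have "grid_map N i \<in> measurable \<mu> cube_borel"
      using measurable_grid_map[OF im] measurable_cong_sets[OF \<mu>'(2) refl] by blast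
    then show "ennreal (mod_matrix N i) * emeasure (distr \<mu> cube_borel (contraction (\<lambda>_. N) (mod_matrix N) i)) A
        = ennreal (1 / real N ^ (CARD('n) - 1)) * emeasure \<mu> (grid_map N i -` A \<inter> cube)"
      using A i by (simp add: contraction_mod_matrix[OF N d im] emeasure_distr \<mu>'(3) mod_matrix_eq)
  qed
  show ?thesis
  proof
    assume "?V = \<mu>"
    then show "\<forall>A\<in>sets cube_borel. emeasure \<mu> A = (\<Sum>i\<in>zero_sum_indices N.
        ennreal (1 / real N ^ (CARD('n) - 1)) * emeasure \<mu> (grid_map N i -` A \<inter> cube))"
      using em by simp
  next
    assume "\<forall>A\<in>sets cube_borel. emeasure \<mu> A = (\<Sum>i\<in>zero_sum_indices N.
        ennreal (1 / real N ^ (CARD('n) - 1)) * emeasure \<mu> (grid_map N i -` A \<inter> cube))"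
    then show "?V = \<mu>"
      using em sets_V \<mu>'(2) by (intro measure_eqI) auto
  qed
qed

lemma markov_fixed_unique:
  fixes \<mu> \<nu> :: "(real ^ 'n::finite) measure"
  assumes N: "N \<ge> 2" and d: "CARD('n) \<ge> 2" and \<mu>: "\<mu> \<in> cube_probs" and \<nu>: "\<nu> \<in> cube_probs"
    and fix_\<mu>: "markov_operator (\<lambda>_. N) (mod_matrix N) \<mu> = \<mu>"
    and fix_\<nu>: "markov_operator (\<lambda>_. N) (mod_matrix N) \<nu> = \<nu>"
  shows "\<mu> = \<nu>"
proof (rule ifs_invariant_measure_unique[where X = cube and I = "zero_sum_indices N" and f = "grid_map N"
      and c = "1 / real N" and p = "\<lambda>_. ennreal (1 / real N ^ (CARD('n) - 1))"])
  have N1: "N \<ge> 1" using N by simp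
  show "bounded (cube :: (real ^ 'n) set)" using compact_cube by (rule compact_imp_bounded)
  show "grid_map N i \<in> restrict_space borel cube \<rightarrow>\<^sub>M restrict_space borel cube"
    if "i \<in> zero_sum_indices N" for i :: "'n \<Rightarrow> nat"
    using measurable_grid_map[of i N] that by (simp add: cube_borel_def zero_sum_indices_def)
  show "1 / real N < 1" using N by simp
  show "emeasure \<mu> A = (\<Sum>i\<in>zero_sum_indices N.
      ennreal (1 / real N ^ (CARD('n) - 1)) * emeasure \<mu> (grid_map N i -` A \<inter> cube))" if "A \<in> sets \<mu>" for A
    using markov_fixed_iff[OF N1 d \<mu>] fix_\<mu> that cube_probsD[OF \<mu>] by simp
  show "emeasure \<nu> A = (\<Sum>i\<in>zero_sum_indices N.
      ennreal (1 / real N ^ (CARD('n) - 1)) * emeasure \<nu> (grid_map N i -` A \<inter> cube))" if "A \<in> sets \<nu>" for A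
    using markov_fixed_iff[OF N1 d \<nu>] fix_\<nu> that cube_probsD[OF \<nu>] by simp
qed (use cube_probsD[OF \<mu>] cube_probsD[OF \<nu>] in \<open>auto simp: dist_grid_map cube_borel_def\<close>)

lemma invariant_measure_eqI:
  fixes \<mu> :: "(real ^ 'n::finite) measure"
  assumes N: "N \<ge> 2" and d: "CARD('n) \<ge> 2" and \<mu>: "\<mu> \<in> cube_probs"
    and fix_\<mu>: "markov_operator (\<lambda>_. N) (mod_matrix N) \<mu> = \<mu>"
  shows "invariant_measure (\<lambda>_. N) (mod_matrix N) = \<mu>"
  unfolding invariant_measure_def
  using assms markov_fixed_unique[OF N d] by (intro the_equality) auto

section \<open>Self-similarity of Lebesgue measure\<close>

lemma space_unit_lebesgue [simp]: "space unit_lebesgue = {0..1}"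
  by (simp add: unit_lebesgue_def space_restrict_space)

lemma space_unit_borel [simp]: "space unit_borel = {0..1}"
  by (simp add: unit_borel_def space_restrict_space)

lemma sets_unit_lebesgue: "sets unit_lebesgue = sets unit_borel"
  by (simp add: unit_lebesgue_def unit_borel_def sets_restrict_space)

lemma emeasure_unit_lebesgue:
  assumes "A \<in> sets unit_borel"
  shows "emeasure unit_lebesgue A = emeasure lborel A" "A \<in> sets borel" "A \<subseteq> {0..1}"
  using assms unfolding unit_lebesgue_def unit_borel_def
  by (auto simp: emeasure_restrict_space sets_restrict_space)

lemma prob_space_unit_lebesgue: "prob_space unit_lebesgue"
proof
  have "{0..1} \<in> sets unit_borel" using sets.top[of unit_borel] by simp
  then show "emeasure unit_lebesgue (space unit_lebesgue) = 1"
    by (simp add: emeasure_unit_lebesgue)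
qed

lemma unit_borel_to_borel: "(\<lambda>x. x) \<in> measurable unit_borel borel"
  unfolding unit_borel_def by (intro measurable_restrict_space1) simp

lemma measurable_unit_shift:
  assumes "k \<in> {1..N}"
  shows "(\<lambda>u. (real k - 1 + u) / real N) \<in> measurable unit_borel unit_borel"
  unfolding unit_borel_def
proof (rule measurable_restrict_space3)
  have "1 \<le> real k" "real k \<le> real N" using assms by auto
  then show "(\<lambda>u. (real k - 1 + u) / real N) \<in> {0..1} \<rightarrow> {0..1}"
    by (auto simp: divide_le_eq)
qed measurable

text \<open>
  Neighbouring grid intervals share an endpoint, which has measure zero.
\<close>

lemma emeasure_lborel_split_grid:
  assumes N: "N \<ge> 1" and A: "A \<in> sets borel" and "K \<le> N"
  shows "(\<Sum>k=1..K. emeasure lborel (A \<inter> {(real k - 1) / real N..real k / real N}))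
      = emeasure lborel (A \<inter> {0..real K / real N})"
  using assms(3)
proof (induction K)
  case 0
  have "emeasure lborel (A \<inter> {0}) \<le> emeasure lborel {0::real}"
    using A by (intro emeasure_mono) auto
  then show ?case by simp
next
  case (Suc K)
  let ?a = "real K / real N" and ?b = "real (Suc K) / real N"
  have ab: "0 \<le> ?a" "?a \<le> ?b" by (auto intro: divide_right_mono)
  have "emeasure lborel (A \<inter> {?a..?b}) = emeasure lborel (A \<inter> {?a<..?b})"
    using A by (intro emeasure_eq_AE eventually_mono[OF AE_lborel_singleton[of ?a]]) auto
  then have "(\<Sum>k=1..Suc K. emeasure lborel (A \<inter> {(real k - 1) / real N..real k / real N}))
      = emeasure lborel (A \<inter> {0..?a}) + emeasure lborel (A \<inter> {?a<..?b})"
    using Suc by simp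
  also have "\<dots> = emeasure lborel ((A \<inter> {0..?a}) \<union> (A \<inter> {?a<..?b}))"
    using A by (intro plus_emeasure) auto
  also have "(A \<inter> {0..?a}) \<union> (A \<inter> {?a<..?b}) = A \<inter> {0..?b}"
    using ab by (auto intro: order_trans[OF ab(1) less_imp_le])
  finally show ?case .
qed

lemma unit_lebesgue_self_similar:
  assumes N: "N \<ge> 1" and A: "A \<in> sets unit_borel"
  shows "emeasure unit_lebesgue A = (\<Sum>k=1..N. ennreal (1 / real N) *
      emeasure unit_lebesgue ((\<lambda>u. (real k - 1 + u) / real N) -` A \<inter> {0..1}))"
proof -
  have Ab: "A \<in> sets borel" and A01: "A \<subseteq> {0..1}"
    using emeasure_unit_lebesgue[OF A] by auto
  have piece: "ennreal (1 / real N) * emeasure unit_lebesgue ((\<lambda>u. (real k - 1 + u) / real N) -` A \<inter> {0..1})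
      = emeasure lborel (A \<inter> {(real k - 1) / real N..real k / real N})" if k: "k \<in> {1..N}" for k
  proof -
    let ?I = "{(real k - 1) / real N..real k / real N}"
    let ?B = "(\<lambda>u. (real k - 1 + u) / real N) -` A \<inter> {0..1}"
    have B: "?B \<in> sets unit_borel"
      using measurable_sets[OF measurable_unit_shift[OF k] A] by simp
    have "emeasure lborel (A \<inter> ?I) = (\<integral>\<^sup>+x. indicator (A \<inter> ?I) x \<partial>lborel)"
      using Ab by simp
    also have "\<dots> = \<bar>1 / real N\<bar> * (\<integral>\<^sup>+x. indicator (A \<inter> ?I) ((real k - 1) / real N + 1 / real N * x) \<partial>lborel)"
      using N Ab by (intro nn_integral_real_affine) auto
    also have "(\<lambda>x. indicator (A \<inter> ?I) ((real k - 1) / real N + 1 / real N * x) :: ennreal) = indicator ?B"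
    proof
      fix x :: real
      have eq: "(real k - 1) / real N + 1 / real N * x = (real k - 1 + x) / real N"
        by (simp add: add_divide_distrib)
      have "(real k - 1 + x) / real N \<in> ?I \<longleftrightarrow> x \<in> {0..1}"
        using N by (auto simp: divide_le_cancel)
      then show "indicator (A \<inter> ?I) ((real k - 1) / real N + 1 / real N * x) = (indicator ?B x :: ennreal)"
        unfolding eq by (auto simp: indicator_def)
    qed
    also have "(\<integral>\<^sup>+x. indicator ?B x \<partial>lborel) = emeasure unit_lebesgue ?B"
      using emeasure_unit_lebesgue[OF B] by simp
    finally show ?thesis by simp
  qed
  have "(\<Sum>k=1..N. ennreal (1 / real N) *
      emeasure unit_lebesgue ((\<lambda>u. (real k - 1 + u) / real N) -` A \<inter> {0..1}))
      = (\<Sum>k=1..N. emeasure lborel (A \<inter> {(real k - 1) / real N..real k / real N}))"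
    by (intro sum.cong piece refl)
  also have "\<dots> = emeasure lborel (A \<inter> {0..real N / real N})"
    by (rule emeasure_lborel_split_grid[OF N Ab order_refl])
  also have "A \<inter> {0..real N / real N} = A" using A01 N by auto
  finally show ?thesis by (simp add: emeasure_unit_lebesgue[OF A])
qed

definition grid_shift :: "nat \<Rightarrow> 'i set \<Rightarrow> ('i \<Rightarrow> nat) \<Rightarrow> ('i \<Rightarrow> real) \<Rightarrow> 'i \<Rightarrow> real" where
  "grid_shift N J e u = (\<lambda>j\<in>J. (real (e j) - 1 + u j) / real N)"

lemma measurable_grid_shift:
  assumes "\<And>j. j \<in> J \<Longrightarrow> e j \<in> {1..N}"
  shows "grid_shift N J e \<in> measurable (PiM J (\<lambda>_. unit_borel)) (PiM J (\<lambda>_. unit_borel))"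
  unfolding grid_shift_def
proof (rule measurable_restrict)
  fix j assume j: "j \<in> J"
  show "(\<lambda>u. (real (e j) - 1 + u j) / real N) \<in> measurable (PiM J (\<lambda>_. unit_borel)) unit_borel"
    using measurable_compose[OF measurable_component_singleton[OF j] measurable_unit_shift[OF assms[OF j]]] .
qed

lemma sets_PiM_unit: "sets (PiM J (\<lambda>_. unit_lebesgue)) = sets (PiM J (\<lambda>_. unit_borel))"
  by (intro sets_PiM_cong sets_unit_lebesgue refl)

lemma space_PiM_unit: "space (PiM J (\<lambda>_. unit_lebesgue)) = space (PiM J (\<lambda>_. unit_borel))"
  by (simp add: space_PiM)

lemma measurable_unit_cong:
  "measurable (PiM J (\<lambda>_. unit_lebesgue)) M = measurable (PiM J (\<lambda>_. unit_borel)) M"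
  "measurable M (PiM J (\<lambda>_. unit_lebesgue)) = measurable M (PiM J (\<lambda>_. unit_borel))"
  by (intro measurable_cong_sets sets_PiM_unit refl)+

lemma product_prob_space_unit_lebesgue: "product_prob_space (\<lambda>_. unit_lebesgue)"
  by (intro product_prob_spaceI prob_space_unit_lebesgue)

text \<open>
  A point of \<open>[0,1]^J\<close> is uniform iff its first digits are uniform and, independently, the remainders
  are uniform.  On boxes the identity is the product of the one-dimensional ones, multiplied out over
  all choices of digits; boxes determine the product measure.
\<close>

lemma PiM_unit_lebesgue_self_similar:
  assumes N: "N \<ge> 1" and J: "finite J" and A: "A \<in> sets (PiM J (\<lambda>_. unit_borel))"
  shows "emeasure (PiM J (\<lambda>_. unit_lebesgue)) A = (\<Sum>e\<in>(\<Pi>\<^sub>E j\<in>J. {1..N}). ennreal (1 / real N ^ card J) *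
      emeasure (PiM J (\<lambda>_. unit_lebesgue)) (grid_shift N J e -` A \<inter> space (PiM J (\<lambda>_. unit_borel))))"
proof -
  interpret product_prob_space "\<lambda>_. unit_lebesgue" J
    by (rule product_prob_space_unit_lebesgue)
  let ?B = "PiM J (\<lambda>_. unit_borel)" and ?L = "PiM J (\<lambda>_. unit_lebesgue)"
  let ?E = "\<Pi>\<^sub>E j\<in>J. {1..N}"
  let ?M = "\<lambda>e. distr ?L ?B (grid_shift N J e)"
  \<comment> \<open>The right-hand side as a measure, to be identified with the product measure on boxes.\<close>
  define P where "P = measure_of (space ?B) (sets ?B) (\<lambda>A. \<Sum>e\<in>?E. ennreal (1 / real N ^ card J) * emeasure (?M e) A)"
  have meas: "grid_shift N J e \<in> measurable ?L ?B" if "e \<in> ?E" for e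
    using measurable_grid_shift[of J e N] that by (auto simp: PiE_iff measurable_unit_cong)
  have P: "emeasure P A = (\<Sum>e\<in>?E. ennreal (1 / real N ^ card J) *
      emeasure ?L (grid_shift N J e -` A \<inter> space ?B))" if A: "A \<in> sets ?B" for A
  proof -
    have "emeasure P A = (\<Sum>e\<in>?E. ennreal (1 / real N ^ card J) * emeasure (?M e) A)"
      unfolding P_def using J A by (intro emeasure_mixture finite_PiE) auto
    also have "\<dots> = (\<Sum>e\<in>?E. ennreal (1 / real N ^ card J) * emeasure ?L (grid_shift N J e -` A \<inter> space ?B))"
      using A meas by (intro sum.cong refl) (simp add: emeasure_distr space_PiM_unit)
    finally show ?thesis .
  qed
  have "P = ?L"
  proof (rule PiM_eqI[OF J])
    show "sets P = sets ?L"
      unfolding P_def sets_PiM_unit by (rule sets.sets_measure_of_eq)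
    fix A :: "'a \<Rightarrow> real set" assume "\<And>j. j \<in> J \<Longrightarrow> A j \<in> sets unit_lebesgue"
    then have A: "\<And>j. j \<in> J \<Longrightarrow> A j \<in> sets unit_borel" by (simp add: sets_unit_lebesgue)
    let ?S = "\<lambda>k j. (\<lambda>u. (real k - 1 + u) / real N) -` A j \<inter> {0..1}"
    have S: "?S k j \<in> sets unit_lebesgue" if "j \<in> J" "k \<in> {1..N}" for k j
      using measurable_sets[OF measurable_unit_shift[OF that(2)] A[OF that(1)]] by (simp add: sets_unit_lebesgue)
    have "emeasure P (Pi\<^sub>E J A) = (\<Sum>e\<in>?E. ennreal (1 / real N ^ card J) *
        emeasure ?L (grid_shift N J e -` (Pi\<^sub>E J A) \<inter> space ?B))"
      using J A by (intro P sets_PiM_I_finite) auto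
    also have "\<dots> = (\<Sum>e\<in>?E. \<Prod>j\<in>J. ennreal (1 / real N) * emeasure unit_lebesgue (?S (e j) j))"
    proof (intro sum.cong refl)
      fix e assume e: "e \<in> ?E"
      have "grid_shift N J e -` (Pi\<^sub>E J A) \<inter> space ?B = (\<Pi>\<^sub>E j\<in>J. ?S (e j) j)"
        by (auto simp: grid_shift_def space_PiM PiE_iff)
      then have "emeasure ?L (grid_shift N J e -` (Pi\<^sub>E J A) \<inter> space ?B)
          = (\<Prod>j\<in>J. emeasure unit_lebesgue (?S (e j) j))"
        using e S J by (simp add: emeasure_PiM PiE_iff)
      moreover have "ennreal (1 / real N ^ card J) = (\<Prod>j\<in>J. ennreal (1 / real N))"
        using N by (simp add: ennreal_power power_divide)
      ultimately show "ennreal (1 / real N ^ card J) * emeasure ?L (grid_shift N J e -` (Pi\<^sub>E J A) \<inter> space ?B)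
          = (\<Prod>j\<in>J. ennreal (1 / real N) * emeasure unit_lebesgue (?S (e j) j))"
        by (simp only: prod.distrib)
    qed
    also have "\<dots> = (\<Prod>j\<in>J. \<Sum>k\<in>{1..N}. ennreal (1 / real N) * emeasure unit_lebesgue (?S k j))"
      by (rule prod_sum_PiE[OF J, symmetric]) simp
    also have "\<dots> = (\<Prod>j\<in>J. emeasure unit_lebesgue (A j))"
      using unit_lebesgue_self_similar[OF N A] by (intro prod.cong refl) simp
    finally show "emeasure P (Pi\<^sub>E J A) = (\<Prod>j\<in>J. emeasure unit_lebesgue (A j))" .
  qed
  then show ?thesis using P[OF A] by simp
qed

section \<open>The measure on the graph of the completing coordinate\<close>

text \<open>
  The \<open>k\<close>-th digit of \<open>x\<close> is the residue of \<open>\<lfloor>N ^ (k + 1) * x\<rfloor>\<close> modulo \<open>N\<close>.  Since only the sum of digits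
  modulo \<open>N\<close> matters, the reduction of the single digits can be left out.
\<close>

definition completion_digit :: "nat \<Rightarrow> 'i set \<Rightarrow> nat \<Rightarrow> ('i \<Rightarrow> real) \<Rightarrow> int" where
  "completion_digit N J k u = (- (\<Sum>j\<in>J. \<lfloor>real N ^ Suc k * u j\<rfloor>)) mod int N"

definition completion :: "nat \<Rightarrow> 'i set \<Rightarrow> ('i \<Rightarrow> real) \<Rightarrow> real" where
  "completion N J u = (\<Sum>k. real_of_int (completion_digit N J k u) / real N ^ Suc k)"

lemma completion_digit_bounds:
  assumes "N \<ge> 1"
  shows "0 \<le> completion_digit N J k u" "completion_digit N J k u \<le> int N - 1"
  using assms pos_mod_bound[of "int N" "- (\<Sum>j\<in>J. \<lfloor>real N ^ Suc k * u j\<rfloor>)"]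
  by (simp_all add: completion_digit_def)

text \<open>
  The largest possible digits represent the number \<open>1\<close>; this bounds every expansion.
\<close>

lemma full_digits_sums:
  assumes "N \<ge> 2"
  shows "(\<lambda>k. (real N - 1) / real N ^ Suc k) sums 1"
proof -
  have "(\<lambda>k. (1 / real N) ^ k) sums (1 / (1 - 1 / real N))"
    using assms by (intro geometric_sums) simp
  then have "(\<lambda>k. ((real N - 1) / real N) * (1 / real N) ^ k) sums (((real N - 1) / real N) * (1 / (1 - 1 / real N)))"
    by (rule sums_mult)
  moreover have "((real N - 1) / real N) * (1 / (1 - 1 / real N)) = 1"
    using assms by (simp add: field_simps)
  ultimately show ?thesis using assms by (simp only: power_divide power_one times_divide_times_eq mult_1_right power_Suc)
qed

lemma completion_bounds:
  assumes N: "N \<ge> 2"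
  shows summable_completion: "summable (\<lambda>k. real_of_int (completion_digit N J k u) / real N ^ Suc k)"
    and completion_nonneg: "0 \<le> completion N J u" and completion_le_1: "completion N J u \<le> 1"
proof -
  let ?f = "\<lambda>k. real_of_int (completion_digit N J k u) / real N ^ Suc k"
  have N1: "N \<ge> 1" using N by simp
  have f0: "0 \<le> ?f k" for k
    using completion_digit_bounds(1)[OF N1, of J k u] by simp
  have f1: "?f k \<le> (real N - 1) / real N ^ Suc k" for k
  proof -
    have "real_of_int (completion_digit N J k u) \<le> real_of_int (int N - 1)"
      using completion_digit_bounds(2)[OF N1, of J k u] by (simp only: of_int_le_iff)
    then show ?thesis by (intro divide_right_mono) auto
  qed
  show sf: "summable ?f"
    by (rule summable_comparison_test'[OF sums_summable[OF full_digits_sums[OF N]], of 0])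
      (simp only: real_norm_def abs_of_nonneg[OF f0] f1)
  show "0 \<le> completion N J u" unfolding completion_def using f0 by (intro suminf_nonneg sf) auto
  have "completion N J u \<le> (\<Sum>k. (real N - 1) / real N ^ Suc k)"
    unfolding completion_def by (intro suminf_le f1 sf sums_summable[OF full_digits_sums[OF N]])
  then show "completion N J u \<le> 1" using sums_unique[OF full_digits_sums[OF N]] by simp
qed

lemma measurable_completion:
  assumes N: "N \<ge> 2"
  shows "completion N J \<in> measurable (PiM J (\<lambda>_. unit_borel)) unit_borel"
proof -
  have comp: "(\<lambda>u. u j) \<in> borel_measurable (PiM J (\<lambda>_. unit_borel))" if "j \<in> J" for j
    using measurable_compose[OF measurable_component_singleton[OF that] unit_borel_to_borel] .
  have fl: "(\<lambda>u. \<Sum>j\<in>J. real_of_int \<lfloor>real N ^ Suc k * u j\<rfloor>) \<in> borel_measurable (PiM J (\<lambda>_. unit_borel))" for k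
    by (intro borel_measurable_sum measurable_compose[OF _ borel_measurable_real_floor] borel_measurable_times
        borel_measurable_const comp)
  \<comment> \<open>The remainder is expressed by real floors, whose measurability is known.\<close>
  have digit: "real_of_int (completion_digit N J k u) =
      - (\<Sum>j\<in>J. real_of_int \<lfloor>real N ^ Suc k * u j\<rfloor>)
      - real N * real_of_int \<lfloor>- (\<Sum>j\<in>J. real_of_int \<lfloor>real N ^ Suc k * u j\<rfloor>) / real N\<rfloor>" for k u
  proof -
    define s where "s = - (\<Sum>j\<in>J. \<lfloor>real N ^ Suc k * u j\<rfloor>)"
    have "real_of_int (s mod int N) = real_of_int s - real N * real_of_int (s div int N)"
      by (simp add: minus_mult_div_eq_mod[symmetric])
    also have "s div int N = \<lfloor>real_of_int s / real N\<rfloor>"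
      by (metis floor_divide_of_int_eq of_int_of_nat_eq)
    finally show ?thesis by (simp add: completion_digit_def s_def)
  qed
  have "completion N J \<in> borel_measurable (PiM J (\<lambda>_. unit_borel))"
    unfolding completion_def[abs_def] digit
    by (intro borel_measurable_suminf borel_measurable_divide borel_measurable_const borel_measurable_diff
        borel_measurable_uminus borel_measurable_times measurable_compose[OF _ borel_measurable_real_floor] fl)
  then have "completion N J \<in> measurable (PiM J (\<lambda>_. unit_borel)) (restrict_space borel {0..1})"
    using completion_bounds[OF N] by (intro measurable_restrict_space2) auto
  then show ?thesis by (simp only: unit_borel_def[symmetric])
qed

text \<open>
  Prefixing digits \<open>e\<close> to all \<open>u j\<close> shifts the digit sequences by one place and creates the new first
  digit sum \<open>\<Sum>j\<in>J. e j - 1\<close>; its completing digit is \<open>l - 1\<close> by the divisibility assumption.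
  The condition \<open>u j < 1\<close> excludes the carry that occurs at \<open>u j = 1\<close>.
\<close>

lemma completion_grid_shift:
  assumes N: "N \<ge> 2" and l: "l \<in> {1..N}" and e: "\<And>j. j \<in> J \<Longrightarrow> e j \<in> {1..N}"
    and dvd: "N dvd (l - 1) + (\<Sum>j\<in>J. e j - 1)"
    and u: "\<And>j. j \<in> J \<Longrightarrow> 0 \<le> u j \<and> u j < 1"
  shows "completion N J (grid_shift N J e u) = (real l - 1 + completion N J u) / real N"
proof -
  let ?v = "grid_shift N J e u"
  let ?f = "\<lambda>k. real_of_int (completion_digit N J k ?v) / real N ^ Suc k"
  have e1: "1 \<le> e j" if "j \<in> J" for j using e[OF that] by simp
  have digit0: "completion_digit N J 0 ?v = int (l - 1)"
  proof -
    have "\<lfloor>real N ^ Suc 0 * ?v j\<rfloor> = int (e j - 1)" if j: "j \<in> J" for j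
    proof -
      have "real N ^ Suc 0 * ?v j = real (e j - 1) + u j"
        using N j e1[OF j] by (simp add: grid_shift_def of_nat_diff)
      then show ?thesis using u[OF j] by (simp add: floor_eq_iff)
    qed
    then have "completion_digit N J 0 ?v = (- int (\<Sum>j\<in>J. e j - 1)) mod int N"
      unfolding completion_digit_def by simp
    also have "\<dots> = int (l - 1) mod int N"
    proof -
      have "int N dvd int (l - 1) + int (\<Sum>j\<in>J. e j - 1)"
        using dvd by (metis int_dvd_int_iff of_nat_add)
      then have "int N dvd int (l - 1) - - int (\<Sum>j\<in>J. e j - 1)" by simp
      then show ?thesis by (metis mod_eq_dvd_iff)
    qed
    also have "\<dots> = int (l - 1)" using l by (intro mod_pos_pos_trivial) auto
    finally show ?thesis .
  qed
  have digit_Suc: "completion_digit N J (Suc k) ?v = completion_digit N J k u" for k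
  proof -
    \<comment> \<open>The prefixed digit contributes a multiple of \<open>N\<close> from the second place on.\<close>
    have "\<lfloor>real N ^ Suc (Suc k) * ?v j\<rfloor> = int N * (int N ^ k * int (e j - 1)) + \<lfloor>real N ^ Suc k * u j\<rfloor>"
      if j: "j \<in> J" for j
    proof -
      have "real N ^ Suc (Suc k) * ?v j = real N ^ Suc k * (real (e j - 1) + u j)"
        using N j e1[OF j] by (simp add: grid_shift_def of_nat_diff)
      also have "\<dots> = real_of_int (int N * (int N ^ k * int (e j - 1))) + real N ^ Suc k * u j"
        by (simp add: algebra_simps)
      finally show ?thesis by (metis floor_add_int add.commute)
    qed
    then have "(\<Sum>j\<in>J. \<lfloor>real N ^ Suc (Suc k) * ?v j\<rfloor>) =
        int N * (\<Sum>j\<in>J. int N ^ k * int (e j - 1)) + (\<Sum>j\<in>J. \<lfloor>real N ^ Suc k * u j\<rfloor>)"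
      by (simp add: sum.distrib sum_distrib_left)
    then have "int N dvd - (\<Sum>j\<in>J. \<lfloor>real N ^ Suc (Suc k) * ?v j\<rfloor>) - - (\<Sum>j\<in>J. \<lfloor>real N ^ Suc k * u j\<rfloor>)"
      by simp
    then show ?thesis unfolding completion_digit_def by (simp only: mod_eq_dvd_iff)
  qed
  have "completion N J ?v = ?f 0 + (\<Sum>k. ?f (Suc k))"
    unfolding completion_def using suminf_split_head[OF summable_completion[OF N, of J ?v]] by linarith
  also have "(\<Sum>k. ?f (Suc k)) = (\<Sum>k. 1 / real N * (real_of_int (completion_digit N J k u) / real N ^ Suc k))"
    by (simp add: digit_Suc)
  also have "\<dots> = 1 / real N * completion N J u"
    unfolding completion_def by (rule suminf_mult[OF summable_completion[OF N]])
  also have "?f 0 = (real l - 1) / real N"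
    using l by (simp add: digit0 of_nat_diff)
  finally show ?thesis by (simp add: add_divide_distrib)
qed

definition completion_graph :: "nat \<Rightarrow> 'n::finite \<Rightarrow> ('n \<Rightarrow> real) \<Rightarrow> real ^ 'n" where
  "completion_graph N j0 u = (\<chi> j. if j = j0 then completion N (-{j0}) u else u j)"

definition completion_graph_measure :: "nat \<Rightarrow> 'n::finite \<Rightarrow> (real ^ 'n) measure" where
  "completion_graph_measure N j0 = distr (face_lebesgue j0) cube_borel (completion_graph N j0)"

lemma borel_measurable_vecI:
  assumes "\<And>j. (\<lambda>x. f x $ j) \<in> borel_measurable M"
  shows "(f :: 'a \<Rightarrow> real ^ 'n::finite) \<in> borel_measurable M"
  using assms by (subst borel_measurable_euclidean_space) (auto simp: Basis_vec_def inner_axis)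

lemma measurable_completion_graph:
  assumes N: "N \<ge> 2"
  shows "completion_graph N (j0 :: 'n::finite) \<in> measurable (face_borel j0) cube_borel"
  unfolding cube_borel_def
proof (rule measurable_restrict_space2)
  show "completion_graph N j0 \<in> space (face_borel j0) \<rightarrow> cube"
    using completion_bounds[OF N] by (auto simp: face_borel_def space_PiM PiE_iff cube_def completion_graph_def)
  show "completion_graph N j0 \<in> borel_measurable (face_borel j0)"
  proof (rule borel_measurable_vecI)
    fix j :: 'n
    show "(\<lambda>u. completion_graph N j0 u $ j) \<in> borel_measurable (face_borel j0)"
    proof (cases "j = j0")
      case True
      then show ?thesis
        using measurable_compose[OF measurable_completion[OF N, of "-{j0}"] unit_borel_to_borel]
        by (simp add: completion_graph_def face_borel_def)
    next
      case False
      then have "j \<in> -{j0}" by simp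
      from measurable_compose[OF measurable_component_singleton[OF this] unit_borel_to_borel]
      show ?thesis using False by (simp add: completion_graph_def face_borel_def)
    qed
  qed
qed

lemma measurable_coordinate: "(\<lambda>x. x $ j) \<in> measurable cube_borel unit_borel"
  unfolding unit_borel_def cube_borel_def
  by (rule measurable_restrict_space3) (auto simp: cube_def)

lemma measurable_proj_del: "proj_del j0 \<in> measurable cube_borel (face_borel (j0 :: 'n::finite))"
  unfolding face_borel_def proj_del_def by (intro measurable_restrict measurable_coordinate)

lemma proj_del_completion_graph:
  assumes "u \<in> space (face_borel j0)"
  shows "proj_del j0 (completion_graph N j0 u) = u"
  using assms by (auto simp: proj_del_def completion_graph_def face_borel_def space_PiM fun_eq_iff PiE_iff extensional_def)

lemma face_measures:
  "prob_space (face_lebesgue j0)" "sets (face_lebesgue j0) = sets (face_borel j0)"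
  "space (face_lebesgue j0) = space (face_borel j0)"
  "measurable (face_lebesgue j0) M = measurable (face_borel j0) M"
  unfolding face_lebesgue_def face_borel_def
  by (intro prob_space_PiM prob_space_unit_lebesgue sets_PiM_unit space_PiM_unit measurable_unit_cong)+

lemma AE_face_less_1: "AE u in face_lebesgue (j0 :: 'n::finite). \<forall>j\<in>-{j0}. 0 \<le> u j \<and> u j < 1"
proof -
  have "AE x in lborel. x \<in> {0..1} \<longrightarrow> 0 \<le> x \<and> x < (1::real)"
    using AE_lborel_singleton[of "1::real"] by (rule eventually_mono) auto
  then have "AE x in unit_lebesgue. 0 \<le> x \<and> x < (1::real)"
    unfolding unit_lebesgue_def by (subst AE_restrict_space_iff) auto
  then show ?thesis
    unfolding face_lebesgue_def
    by (intro AE_finite_allI AE_PiM_component prob_space_unit_lebesgue) auto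
qed

lemma completion_graph_measure_in_cube_probs:
  assumes N: "N \<ge> 2"
  shows "completion_graph_measure N j0 \<in> cube_probs"
proof -
  have "completion_graph N j0 \<in> measurable (face_lebesgue j0) cube_borel"
    using measurable_completion_graph[OF N] by (simp add: face_measures)
  from prob_space.prob_space_distr[OF face_measures(1) this]
  show ?thesis by (simp add: completion_graph_measure_def cube_probs_def)
qed

text \<open>
  The graph is mapped into itself by the grid maps of zero-sum digit vectors, up to the points with
  a coordinate \<open>1\<close> on the face.
\<close>

lemma completion_graph_grid_shift:
  assumes N: "N \<ge> 2" and i: "i \<in> zero_sum_indices N"
    and u: "\<And>j. j \<in> -{j0} \<Longrightarrow> 0 \<le> u j \<and> u j < 1"
  shows "completion_graph N j0 (grid_shift N (-{j0}) (restrict i (-{j0})) u) = grid_map N i (completion_graph N j0 u)"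
proof -
  have im: "i j \<in> {1..N}" for j using i by (simp add: zero_sum_indices_def multi_indices_def)
  have "N dvd (\<Sum>j\<in>UNIV. i j - 1)" using i by (simp add: zero_sum_indices_def)
  then have "N dvd (i j0 - 1) + (\<Sum>j\<in>-{j0}. i j - 1)"
    using digit_sum_upd[of i j0 "i j0"] by (simp only: fun_upd_triv)
  also have "(\<Sum>j\<in>-{j0}. i j - 1) = (\<Sum>j\<in>-{j0}. restrict i (-{j0}) j - 1)"
    by (intro sum.cong) auto
  finally have "completion N (-{j0}) (grid_shift N (-{j0}) (restrict i (-{j0})) u)
      = (real (i j0) - 1 + completion N (-{j0}) u) / real N"
    using im u by (intro completion_grid_shift[OF N]) auto
  then show ?thesis
    by (simp add: vec_eq_iff completion_graph_def grid_map_def) (simp add: grid_shift_def)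
qed

text \<open>
  Split the uniform law on the face by its first digits, reindex the digit vectors of the face by
  the zero-sum vectors, and move each shift through the graph map.
\<close>

lemma completion_graph_measure_fixed:
  fixes j0 :: "'n::finite"
  assumes N: "N \<ge> 2" and d: "CARD('n) \<ge> 2"
  shows "markov_operator (\<lambda>_. N) (mod_matrix N) (completion_graph_measure N j0) = completion_graph_measure N j0"
proof -
  let ?\<mu> = "completion_graph_measure N j0" and ?G = "completion_graph N j0" and ?J = "-{j0}"
  let ?L = "face_lebesgue j0" and ?w = "ennreal (1 / real N ^ (CARD('n) - 1))"
  let ?r = "\<lambda>i. restrict i ?J"
  have N1: "N \<ge> 1" using N by simp
  have G: "?G \<in> measurable ?L cube_borel"
    using measurable_completion_graph[OF N] by (simp add: face_measures)
  have "emeasure ?\<mu> A = (\<Sum>i\<in>zero_sum_indices N. ?w * emeasure ?\<mu> (grid_map N i -` A \<inter> cube))"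
    if A: "A \<in> sets cube_borel" for A
  proof -
    have GA: "?G -` A \<inter> space ?L \<in> sets (PiM ?J (\<lambda>_. unit_borel))"
      using measurable_sets[OF G A] by (simp add: face_measures face_borel_def)
    have "emeasure ?\<mu> A = emeasure ?L (?G -` A \<inter> space ?L)"
      unfolding completion_graph_measure_def by (rule emeasure_distr[OF G A])
    also have "\<dots> = (\<Sum>e\<in>(\<Pi>\<^sub>E j\<in>?J. {1..N}). ?w *
        emeasure ?L (grid_shift N ?J e -` (?G -` A \<inter> space ?L) \<inter> space ?L))"
      using PiM_unit_lebesgue_self_similar[OF N1 _ GA]
      by (simp add: card_compl_singleton face_lebesgue_def space_PiM_unit)
    also have "\<dots> = (\<Sum>i\<in>zero_sum_indices N. ?w *
        emeasure ?L (grid_shift N ?J (?r i) -` (?G -` A \<inter> space ?L) \<inter> space ?L))"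
      by (rule sum.reindex_bij_betw[OF bij_betw_delete_coordinate[OF N1], symmetric])
    also have "\<dots> = (\<Sum>i\<in>zero_sum_indices N. ?w * emeasure ?\<mu> (grid_map N i -` A \<inter> cube))"
    proof (intro sum.cong refl arg_cong[where f = "\<lambda>x. ?w * x"])
      fix i :: "'n \<Rightarrow> nat" assume i: "i \<in> zero_sum_indices N"
      then have im: "i \<in> multi_indices (\<lambda>_. N)" by (simp add: zero_sum_indices_def)
      have shift: "grid_shift N ?J (?r i) \<in> measurable ?L ?L"
        using measurable_grid_shift[of ?J "?r i" N] im
        by (simp add: face_lebesgue_def measurable_unit_cong multi_indices_def)
      have B: "grid_map N i -` A \<inter> cube \<in> sets cube_borel"
        using measurable_sets[OF measurable_grid_map[OF im] A] by simp
      have "emeasure ?L (grid_shift N ?J (?r i) -` (?G -` A \<inter> space ?L) \<inter> space ?L)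
          = emeasure ?L (?G -` (grid_map N i -` A \<inter> cube) \<inter> space ?L)"
      proof (rule emeasure_eq_AE)
        show "AE u in ?L. u \<in> grid_shift N ?J (?r i) -` (?G -` A \<inter> space ?L) \<inter> space ?L \<longleftrightarrow>
            u \<in> ?G -` (grid_map N i -` A \<inter> cube) \<inter> space ?L"
          using AE_face_less_1[of j0] AE_space
        proof eventually_elim
          case (elim u)
          have "grid_shift N ?J (?r i) u \<in> space ?L" "?G u \<in> cube"
            using measurable_space[OF shift] measurable_space[OF G] elim by auto
          then show ?case
            using elim completion_graph_grid_shift[OF N i, of j0 u] by auto
        qed
        show "grid_shift N ?J (?r i) -` (?G -` A \<inter> space ?L) \<inter> space ?L \<in> sets ?L"
          by (rule measurable_sets[OF shift measurable_sets[OF G A]])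
        show "?G -` (grid_map N i -` A \<inter> cube) \<inter> space ?L \<in> sets ?L"
          by (rule measurable_sets[OF G B])
      qed
      also have "\<dots> = emeasure ?\<mu> (grid_map N i -` A \<inter> cube)"
        unfolding completion_graph_measure_def by (rule emeasure_distr[OF G B, symmetric])
      finally show "emeasure ?L (grid_shift N ?J (?r i) -` (?G -` A \<inter> space ?L) \<inter> space ?L)
          = emeasure ?\<mu> (grid_map N i -` A \<inter> cube)" .
    qed
    finally show ?thesis .
  qed
  then show ?thesis
    using markov_fixed_iff[OF N1 d completion_graph_measure_in_cube_probs[OF N]] by blast
qed

text \<open>
  By uniqueness the graph measures over all faces coincide.  The left-hand side does not mention
  \<open>j0\<close>, so every coordinate can be treated as the completing one.
\<close>

lemma invariant_measure_eq_graph: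
  fixes j0 :: "'n::finite"
  assumes "N \<ge> 2" and "CARD('n) \<ge> 2"
  shows "invariant_measure (\<lambda>_. N) (mod_matrix N) = completion_graph_measure N j0"
  by (intro invariant_measure_eqI completion_graph_measure_in_cube_probs completion_graph_measure_fixed assms)

text \<open>
  For a face, use the graph over that face.  For a one-dimensional marginal, use the graph over any
  face that contains this coordinate.
\<close>

lemma invariant_measure_uniform_faces:
  assumes N: "N \<ge> 2" and d: "CARD('n::finite) \<ge> 2"
  shows "(invariant_measure (\<lambda>_. N) (mod_matrix N) :: (real ^ 'n) measure) \<in> stochastic_measures_uniform_faces"
proof -
  let ?\<mu> = "invariant_measure (\<lambda>_. N) (mod_matrix N) :: (real ^ 'n) measure"
  have G: "completion_graph N j0 \<in> measurable (face_lebesgue j0) cube_borel" for j0 :: 'n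
    using measurable_completion_graph[OF N] by (simp add: face_measures)
  have "?\<mu> \<in> cube_probs"
    using invariant_measure_eq_graph[OF N d] completion_graph_measure_in_cube_probs[OF N] by metis
  moreover have "distr ?\<mu> (face_borel j0) (proj_del j0) = face_lebesgue j0" for j0
  proof -
    have "distr ?\<mu> (face_borel j0) (proj_del j0)
        = distr (face_lebesgue j0) (face_borel j0) (proj_del j0 \<circ> completion_graph N j0)"
      unfolding invariant_measure_eq_graph[OF N d, of j0] completion_graph_measure_def
      by (rule distr_distr[OF measurable_proj_del G])
    also have "\<dots> = distr (face_lebesgue j0) (face_lebesgue j0) (\<lambda>u. u)"
      by (intro distr_cong refl) (simp_all add: face_measures proj_del_completion_graph)
    finally show ?thesis by (simp add: distr_id)
  qed
  moreover have "distr ?\<mu> unit_borel (\<lambda>x. x $ j) = unit_lebesgue" for j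
  proof -
    obtain j0 where j0: "j0 \<noteq> j" using ex_other_index[OF d] by blast
    have "distr ?\<mu> unit_borel (\<lambda>x. x $ j)
        = distr (face_lebesgue j0) unit_borel ((\<lambda>x. x $ j) \<circ> completion_graph N j0)"
      unfolding invariant_measure_eq_graph[OF N d, of j0] completion_graph_measure_def
      by (rule distr_distr[OF measurable_coordinate G])
    also have "\<dots> = distr (PiM (-{j0}) (\<lambda>_. unit_lebesgue)) unit_lebesgue (\<lambda>u. u j)"
      using j0 by (intro distr_cong) (simp_all add: face_lebesgue_def sets_unit_lebesgue completion_graph_def)
    also have "\<dots> = unit_lebesgue"
      using j0 by (intro distr_PiM_component prob_space_unit_lebesgue) simp
    finally show ?thesis .
  qed
  ultimately show ?thesis
    by (simp add: stochastic_measures_uniform_faces_def stochastic_measures_def)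
qed

lemma coordinate_determined:
  fixes X :: "'w \<Rightarrow> real ^ 'n::finite"
  assumes N: "N \<ge> 2" and d: "CARD('n) \<ge> 2" and X: "X \<in> measurable M cube_borel"
    and distr: "distr M cube_borel X = invariant_measure (\<lambda>_. N) (mod_matrix N)"
  shows "AE \<omega> in M. X \<omega> $ j = completion N (-{j}) (proj_del j (X \<omega>))"
proof -
  have G: "completion_graph N j \<in> measurable (face_lebesgue j) cube_borel"
    using measurable_completion_graph[OF N] by (simp add: face_measures)
  have cp: "(\<lambda>x. completion N (-{j}) (proj_del j x)) \<in> borel_measurable cube_borel"
    using measurable_compose[OF measurable_compose[OF measurable_proj_del] unit_borel_to_borel, of "completion N (-{j})" j]
      measurable_completion[OF N, of "-{j}"] by (simp add: face_borel_def)
  have cj: "(\<lambda>x. x $ j) \<in> borel_measurable cube_borel"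
    using measurable_compose[OF measurable_coordinate unit_borel_to_borel] .
  have set: "{x \<in> space cube_borel. x $ j = completion N (-{j}) (proj_del j x)} \<in> sets cube_borel"
    by (rule borel_measurable_eq[OF cj cp])
  have "AE u in face_lebesgue j. completion_graph N j u $ j = completion N (-{j}) (proj_del j (completion_graph N j u))"
    using AE_space by eventually_elim
      (simp add: face_measures proj_del_completion_graph, simp add: completion_graph_def)
  then have "AE x in completion_graph_measure N j. x $ j = completion N (-{j}) (proj_del j x)"
    unfolding completion_graph_measure_def using AE_distr_iff[OF G set] by simp
  then have "AE x in distr M cube_borel X. x $ j = completion N (-{j}) (proj_del j x)"
    by (simp only: distr invariant_measure_eq_graph[OF N d, of j])
  then show ?thesis using AE_distr_iff[OF X set] by simp
qed

section \<open>Hausdorff measure\<close>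

text \<open>
  The enumeration of the cover is continued by empty sets, which contribute nothing.
\<close>

lemma hausdorff_content_le_finite_cover:
  fixes A :: "'a::metric_space set"
  assumes "finite F" "A \<subseteq> \<Union>F" and F: "\<And>C. C \<in> F \<Longrightarrow> bounded C \<and> diameter C \<le> r"
    and r: "0 \<le> r" "r \<le> \<delta>" and s: "s > 0"
  shows "hausdorff_content s \<delta> A \<le> ennreal (real (card F) * r powr s)"
proof -
  obtain h where h: "bij_betw h {0..<card F} F"
    using ex_bij_betw_nat_finite[OF assms(1)] by blast
  define C where "C n = (if n < card F then h n else {})" for n
  have hF: "h n \<in> F" if "n < card F" for n using bij_betwE[OF h] that by simp
  have "A \<subseteq> (\<Union>n. C n)"
  proof
    fix x assume "x \<in> A"
    then obtain X where "X \<in> F" "x \<in> X" using assms(2) by blast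
    moreover then obtain n where "n < card F" "h n = X"
      using bij_betw_imp_surj_on[OF h] by (metis atLeastLessThan_iff imageE)
    ultimately show "x \<in> (\<Union>n. C n)" by (auto simp: C_def)
  qed
  moreover have "bounded (C n) \<and> diameter (C n) \<le> \<delta>" for n
    using F[OF hF] r by (force simp: C_def)
  ultimately have "hausdorff_content s \<delta> A \<le> (\<Sum>n. diam_pow s (C n))"
    unfolding hausdorff_content_def by (intro INF_lower) simp
  also have "\<dots> = (\<Sum>n<card F. diam_pow s (C n))"
    by (intro suminf_finite) (auto simp: C_def diam_pow_def)
  also have "\<dots> \<le> (\<Sum>n<card F. ennreal (r powr s))"
  proof (intro sum_mono)
    fix n assume "n \<in> {..<card F}"
    then have "bounded (C n)" "diameter (C n) \<le> r" using F[OF hF] by (simp_all add: C_def)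
    then have "diameter (C n) powr s \<le> r powr s"
      using s by (intro powr_mono2 diameter_ge_0) auto
    then show "diam_pow s (C n) \<le> ennreal (r powr s)"
      using s by (simp add: diam_pow_def ennreal_leI)
  qed
  also have "\<dots> = ennreal (real (card F) * r powr s)"
    by (simp add: ennreal_mult' ennreal_of_nat_eq_real_of_nat)
  finally show ?thesis .
qed

text \<open>
  At level \<open>n\<close> the cover contributes at most \<open>D powr s * (M / b powr s) ^ n\<close>, which
  tends to \<open>0\<close> because \<open>M < b powr s\<close>.
\<close>

lemma hausdorff_measure_eq_0_of_covers:
  fixes A :: "'a::metric_space set" and D b :: real and M :: nat
  assumes cover: "\<And>n. \<exists>F. finite F \<and> card F \<le> M ^ n \<and> A \<subseteq> \<Union>F \<and> (\<forall>C\<in>F. bounded C \<and> diameter C \<le> D / b ^ n)"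
    and D: "D \<ge> 0" and b: "b > 1" and s: "s > 0" and M: "real M < b powr s"
  shows "hausdorff_measure s A = 0"
proof -
  have "hausdorff_content s \<delta> A = 0" if \<delta>: "\<delta> > 0" for \<delta>
  proof -
    have "(\<lambda>n. D * (1 / b) ^ n) \<longlonglongrightarrow> 0"
      using b by (intro tendsto_mult_right_zero LIMSEQ_realpow_zero) auto
    then have "eventually (\<lambda>n. D * (1 / b) ^ n < \<delta>) sequentially"
      using \<delta> by (rule order_tendstoD(2))
    then have ev: "eventually (\<lambda>n. hausdorff_content s \<delta> A \<le> ennreal (D powr s * (real M / b powr s) ^ n)) sequentially"
    proof eventually_elim
      case (elim n)
      then have r: "D / b ^ n \<le> \<delta>" by (simp add: power_divide)
      obtain F where F: "finite F" "card F \<le> M ^ n" "A \<subseteq> \<Union>F" "\<And>C. C \<in> F \<Longrightarrow> bounded C \<and> diameter C \<le> D / b ^ n"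
        using cover[of n] by blast
      have "hausdorff_content s \<delta> A \<le> ennreal (real (card F) * (D / b ^ n) powr s)"
        using b D by (intro hausdorff_content_le_finite_cover F r s) auto
      also have "\<dots> \<le> ennreal (real M ^ n * (D / b ^ n) powr s)"
      proof (intro ennreal_leI mult_right_mono)
        show "real (card F) \<le> real M ^ n" using F(2) by (metis of_nat_le_iff of_nat_power)
      qed simp
      also have "(D / b ^ n) powr s = D powr s / (b powr s) ^ n"
      proof -
        have "(b ^ n) powr s = (b powr s) ^ n"
          using b by (simp add: powr_realpow[symmetric] powr_powr mult.commute)
        then show ?thesis using D b by (simp add: powr_divide)
      qed
      also have "real M ^ n * (D powr s / (b powr s) ^ n) = D powr s * (real M / b powr s) ^ n"
        by (simp add: power_divide)
      finally show ?case .
    qed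
    have "(\<lambda>n. D powr s * (real M / b powr s) ^ n) \<longlonglongrightarrow> 0"
      using M b by (intro tendsto_mult_right_zero LIMSEQ_realpow_zero) auto
    then have "(\<lambda>n. ennreal (D powr s * (real M / b powr s) ^ n)) \<longlonglongrightarrow> ennreal 0"
      by (rule tendsto_ennrealI)
    then have "hausdorff_content s \<delta> A \<le> ennreal 0"
      using ev by (rule tendsto_lowerbound) simp
    then show ?thesis by simp
  qed
  then show ?thesis unfolding hausdorff_measure_def by simp
qed

text \<open>
  The mass distribution principle: a set that carries mass cannot be covered cheaply if small sets
  carry little mass.  The sets \<open>B\<close> are there because the members of a cover need not be measurable.
\<close>

lemma hausdorff_content_mass_distribution:
  fixes A :: "'a::metric_space set" and c :: ennreal
  assumes c: "c > 0"
    and mass: "\<And>C. C \<noteq> {} \<Longrightarrow> bounded C \<Longrightarrow> diameter C \<le> \<delta> \<Longrightarrow>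
      \<exists>B\<in>sets M. C \<inter> A \<subseteq> B \<and> emeasure M B \<le> c * diam_pow s C"
  shows "emeasure M A / c \<le> hausdorff_content s \<delta> A"
  unfolding hausdorff_content_def
proof (rule INF_greatest, rule divide_le_posI_ennreal[OF c])
  fix C :: "nat \<Rightarrow> 'a set"
  assume "C \<in> {C. A \<subseteq> (\<Union>n. C n) \<and> (\<forall>n. bounded (C n) \<and> diameter (C n) \<le> \<delta>)}"
  then have C: "A \<subseteq> (\<Union>n. C n)" "\<And>n. bounded (C n)" "\<And>n. diameter (C n) \<le> \<delta>" by auto
  have "\<exists>B\<in>sets M. C n \<inter> A \<subseteq> B \<and> emeasure M B \<le> c * diam_pow s (C n)" for n
    using mass[OF _ C(2,3)] by (cases "C n = {}") (auto intro!: bexI[of _ "{}"])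
  then obtain B where B: "\<And>n. B n \<in> sets M" "\<And>n. C n \<inter> A \<subseteq> B n"
    "\<And>n. emeasure M (B n) \<le> c * diam_pow s (C n)" by metis
  have "A \<subseteq> (\<Union>n. B n)"
  proof
    fix a assume a: "a \<in> A"
    then obtain n where "a \<in> C n" using C(1) by blast
    then show "a \<in> (\<Union>n. B n)" using B(2)[of n] a by blast
  qed
  then have "emeasure M A \<le> emeasure M (\<Union>n. B n)"
    using B(1) by (intro emeasure_mono) auto
  also have "\<dots> \<le> (\<Sum>n. emeasure M (B n))"
    using B(1) by (intro emeasure_subadditive_countably) auto
  also have "\<dots> \<le> (\<Sum>n. c * diam_pow s (C n))"
    by (intro suminf_le B(3)) auto
  finally show "emeasure M A \<le> c * (\<Sum>n. diam_pow s (C n))" by simp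
qed

lemma diameter_power_le_diam_pow:
  fixes C :: "'a::metric_space set"
  assumes "C \<noteq> {}" "bounded C" "diameter C \<le> 1" "0 \<le> s" "s \<le> real k" "k \<ge> 1"
  shows "ennreal (diameter C ^ k) \<le> diam_pow s C"
proof -
  have d0: "0 \<le> diameter C" using diameter_ge_0[OF assms(2)] .
  have "diameter C ^ k \<le> (if s = 0 then 1 else diameter C powr s)"
  proof (cases "s = 0")
    case True
    then show ?thesis using d0 assms(3) by (simp add: power_le_one)
  next
    case False
    have "diameter C ^ k = diameter C powr real k"
      using d0 assms(6) by (cases "diameter C = 0") (auto simp: powr_realpow)
    then show ?thesis using False powr_mono'[OF assms(5) d0 assms(3)] by simp
  qed
  then show ?thesis using assms(1) by (auto simp: diam_pow_def intro: ennreal_leI)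
qed

text \<open>
  A set of diameter \<open>r\<close> lies in the box of side \<open>2 * r\<close> around any of its points.
\<close>

lemma face_mass_of_diameter:
  fixes C :: "(real ^ 'n::finite) set" and j0 :: 'n
  assumes C: "C \<noteq> {}" "bounded C"
  shows "\<exists>B\<in>sets (face_lebesgue j0). {u \<in> space (face_lebesgue j0). \<exists>x\<in>C. proj_del j0 x = u} \<subseteq> B \<and>
    emeasure (face_lebesgue j0) B \<le> ennreal ((2 * diameter C) ^ (CARD('n) - 1))"
proof -
  interpret product_prob_space "\<lambda>_. unit_lebesgue" "-{j0}"
    by (rule product_prob_space_unit_lebesgue)
  obtain p where p: "p \<in> C" using C by blast
  let ?r = "diameter C"
  let ?I = "\<lambda>j. {p $ j - ?r..p $ j + ?r} \<inter> {0..1}"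
  have r0: "0 \<le> ?r" by (rule diameter_ge_0[OF C(2)])
  have I: "?I j \<in> sets unit_borel" for j
    unfolding unit_borel_def sets_restrict_space by (subst Int_commute) (intro imageI, simp)
  have I_le: "emeasure unit_lebesgue (?I j) \<le> ennreal (2 * ?r)" for j
  proof -
    have "emeasure unit_lebesgue (?I j) \<le> emeasure lborel {p $ j - ?r..p $ j + ?r}"
      unfolding emeasure_unit_lebesgue(1)[OF I] by (intro emeasure_mono) auto
    then show ?thesis using r0 by simp
  qed
  show ?thesis
  proof (intro bexI[of _ "\<Pi>\<^sub>E j\<in>-{j0}. ?I j"] conjI)
    show "{u \<in> space (face_lebesgue j0). \<exists>x\<in>C. proj_del j0 x = u} \<subseteq> (\<Pi>\<^sub>E j\<in>-{j0}. ?I j)"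
    proof clarify
      fix x assume x: "x \<in> C" and u: "proj_del j0 x \<in> space (face_lebesgue j0)"
      have xp: "\<bar>x $ j - p $ j\<bar> \<le> ?r" for j
        using component_le_norm_cart[of "x - p" j] diameter_bounded_bound[OF C(2) x p]
        by (simp add: dist_norm)
      show "proj_del j0 x \<in> (\<Pi>\<^sub>E j\<in>-{j0}. ?I j)"
      proof (rule PiE_I)
        fix j assume j: "j \<in> -{j0}"
        have "proj_del j0 x j \<in> {0..1}" using u j by (auto simp: face_lebesgue_def space_PiM PiE_iff)
        then show "proj_del j0 x j \<in> ?I j"
          using xp[of j] j by (auto simp: proj_del_def abs_le_iff)
      qed (simp add: proj_del_def)
    qed
    show "(\<Pi>\<^sub>E j\<in>-{j0}. ?I j) \<in> sets (face_lebesgue j0)"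
      unfolding face_lebesgue_def using I by (intro sets_PiM_I_finite) (auto simp: sets_unit_lebesgue)
    have "emeasure (face_lebesgue j0) (\<Pi>\<^sub>E j\<in>-{j0}. ?I j) = (\<Prod>j\<in>-{j0}. emeasure unit_lebesgue (?I j))"
      unfolding face_lebesgue_def using I by (intro emeasure_PiM) (auto simp: sets_unit_lebesgue)
    also have "\<dots> \<le> (\<Prod>j\<in>-{j0}. ennreal (2 * ?r))"
      by (intro prod_mono_ennreal I_le)
    also have "\<dots> = ennreal ((2 * ?r) ^ (CARD('n) - 1))"
      using r0 by (simp add: card_compl_singleton ennreal_power)
    finally show "emeasure (face_lebesgue j0) (\<Pi>\<^sub>E j\<in>-{j0}. ?I j) \<le> ennreal ((2 * ?r) ^ (CARD('n) - 1))" .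
  qed
qed

text \<open>
  Since one face projection of \<open>\<mu>\<close> is uniform, a set of diameter \<open>r \<le> 1\<close> has \<open>\<mu>\<close>-measure at most
  \<open>(2 * r) ^ (d - 1) \<le> 2 ^ (d - 1) * r powr s\<close>.
\<close>

lemma hausdorff_measure_pos_of_uniform_face:
  fixes \<mu> :: "(real ^ 'n::finite) measure" and j0 :: 'n
  assumes d: "CARD('n) \<ge> 2" and \<mu>: "\<mu> \<in> cube_probs"
    and face: "distr \<mu> (face_borel j0) (proj_del j0) = face_lebesgue j0"
    and K: "K \<in> sets \<mu>" "emeasure \<mu> K = 1" and s: "0 \<le> s" "s \<le> real (CARD('n) - 1)"
  shows "hausdorff_measure s K > 0"
proof -
  let ?k = "CARD('n) - 1"
  let ?c = "ennreal (2 ^ ?k)"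
  note \<mu>' = cube_probsD[OF \<mu>]
  have pm: "proj_del j0 \<in> measurable \<mu> (face_borel j0)"
    using measurable_proj_del measurable_cong_sets[OF \<mu>'(2) refl] by blast
  have "emeasure \<mu> K / ?c \<le> hausdorff_content s 1 K"
  proof (rule hausdorff_content_mass_distribution)
    fix C :: "(real ^ 'n) set" assume C: "C \<noteq> {}" "bounded C" "diameter C \<le> 1"
    obtain B where B: "B \<in> sets (face_lebesgue j0)"
      "{u \<in> space (face_lebesgue j0). \<exists>x\<in>C. proj_del j0 x = u} \<subseteq> B"
      "emeasure (face_lebesgue j0) B \<le> ennreal ((2 * diameter C) ^ ?k)"
      using face_mass_of_diameter[OF C(1,2), of j0] by blast
    let ?B = "proj_del j0 -` B \<inter> space \<mu>"
    have Bf: "B \<in> sets (face_borel j0)" using B(1) by (simp add: face_measures)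
    show "\<exists>B\<in>sets \<mu>. C \<inter> K \<subseteq> B \<and> emeasure \<mu> B \<le> ?c * diam_pow s C"
    proof (intro bexI[of _ ?B] conjI)
      show "?B \<in> sets \<mu>" by (rule measurable_sets[OF pm Bf])
      show "C \<inter> K \<subseteq> ?B"
      proof
        fix x assume "x \<in> C \<inter> K"
        then have x: "x \<in> C" "x \<in> space \<mu>" using sets.sets_into_space[OF K(1)] by auto
        then have "proj_del j0 x \<in> space (face_lebesgue j0)"
          using measurable_space[OF pm] by (simp add: face_measures)
        then show "x \<in> ?B" using B(2) x by blast
      qed
      have "emeasure \<mu> ?B = emeasure (face_lebesgue j0) B"
        unfolding face[symmetric] by (rule emeasure_distr[OF pm Bf, symmetric])
      also have "\<dots> \<le> ennreal ((2 * diameter C) ^ ?k)" by (rule B(3))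
      also have "\<dots> = ?c * ennreal (diameter C ^ ?k)"
        using diameter_ge_0[OF C(2)] by (simp add: power_mult_distrib ennreal_mult')
      also have "\<dots> \<le> ?c * diam_pow s C"
        using C s d by (intro mult_left_mono diameter_power_le_diam_pow) auto
      finally show "emeasure \<mu> ?B \<le> ?c * diam_pow s C" .
    qed
  qed simp
  also have "\<dots> \<le> hausdorff_measure s K"
    unfolding hausdorff_measure_def by (intro SUP_upper) simp
  finally have "1 / ?c \<le> hausdorff_measure s K" using K(2) by simp
  moreover have "0 < 1 / ?c" by (simp add: ennreal_zero_less_divide)
  ultimately show ?thesis by (rule less_le_trans[rotated])
qed

lemma hausdorff_dimension_eqI:
  fixes A :: "'a::metric_space set"
  assumes k: "0 \<le> k" and upper: "\<And>s. s > k \<Longrightarrow> hausdorff_measure s A = 0"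
    and lower: "\<And>s. 0 \<le> s \<Longrightarrow> s < k \<Longrightarrow> hausdorff_measure s A \<noteq> 0"
  shows "hausdorff_dimension A = ennreal k"
proof (rule antisym)
  show "hausdorff_dimension A \<le> ennreal k"
  proof (rule ennreal_le_epsilon)
    fix e :: real assume e: "0 < e"
    then have "hausdorff_measure (k + e) A = 0" by (intro upper) simp
    then have "hausdorff_dimension A \<le> ennreal (k + e)"
      unfolding hausdorff_dimension_def using k e by (intro Inf_lower) (auto intro!: exI[of _ "k + e"])
    then show "hausdorff_dimension A \<le> ennreal k + ennreal e" using k e by simp
  qed
  show "ennreal k \<le> hausdorff_dimension A"
    unfolding hausdorff_dimension_def
    using lower by (intro Inf_greatest) (force intro!: ennreal_leI simp: not_less[symmetric])
qed

section \<open>The support\<close>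

lemma measure_support_eq_Diff:
  "measure_support \<mu> = space \<mu> - \<Union>{U. open U \<and> emeasure \<mu> (U \<inter> space \<mu>) = 0}"
  by (auto simp: measure_support_def zero_less_iff_neq_zero)

lemma closed_measure_support:
  assumes "closed (space \<mu>)"
  shows "closed (measure_support \<mu>)"
  unfolding measure_support_eq_Diff using assms by (intro closed_Diff open_Union) auto

text \<open>
  The complement of the support is a union of null open sets; a countable subfamily already covers
  it.
\<close>

lemma null_Diff_measure_support:
  fixes \<mu> :: "'a::second_countable_topology measure"
  assumes "sets \<mu> = sets (restrict_space borel X)"
  shows "space \<mu> - measure_support \<mu> \<in> null_sets \<mu>"
proof -
  have sp: "space \<mu> = X" using sets_eq_imp_space_eq[OF assms] by (simp add: space_restrict_space)
  let ?F = "{U. open U \<and> emeasure \<mu> (U \<inter> space \<mu>) = 0}"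
  obtain F' where F': "F' \<subseteq> ?F" "countable F'" "\<Union>F' = \<Union>?F"
    using Lindelof[of ?F] by auto
  have "(\<Union>U\<in>F'. U \<inter> space \<mu>) \<in> null_sets \<mu>"
  proof (rule null_sets_UN'[OF F'(2)])
    fix U assume "U \<in> F'"
    then have U: "open U" "emeasure \<mu> (U \<inter> space \<mu>) = 0" using F'(1) by auto
    have "X \<inter> U \<in> sets \<mu>"
      unfolding assms sets_restrict_space using U(1) by (intro imageI borel_open)
    then show "U \<inter> space \<mu> \<in> null_sets \<mu>"
      using U(2) by (intro null_setsI) (simp_all add: sp Int_commute)
  qed
  also have "(\<Union>U\<in>F'. U \<inter> space \<mu>) = space \<mu> - measure_support \<mu>"
    unfolding measure_support_eq_Diff F'(3)[symmetric] by auto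
  finally show ?thesis .
qed

lemma measure_support_emeasure_pos:
  assumes "x \<in> measure_support \<mu>" "open U" "x \<in> U"
  shows "emeasure \<mu> (U \<inter> space \<mu>) > 0"
  using assms by (auto simp: measure_support_def)

context
  fixes N :: nat and \<mu> :: "(real ^ 'n::finite) measure"
  assumes N: "N \<ge> 2" and d: "CARD('n) \<ge> 2" and \<mu>: "\<mu> \<in> cube_probs"
    and fixed: "markov_operator (\<lambda>_. N) (mod_matrix N) \<mu> = \<mu>"
begin

lemma emeasure_fixed:
  assumes "open U"
  shows "emeasure \<mu> (U \<inter> cube) = (\<Sum>i\<in>zero_sum_indices N.
      ennreal (1 / real N ^ (CARD('n) - 1)) * emeasure \<mu> ((grid_map N i -` U) \<inter> cube))"
proof -
  have N1: "N \<ge> 1" using N by simp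
  have "U \<inter> cube \<in> sets cube_borel"
    unfolding cube_borel_def sets_restrict_space Int_commute[of U] using assms by (intro imageI borel_open)
  then have "emeasure \<mu> (U \<inter> cube) = (\<Sum>i\<in>zero_sum_indices N.
      ennreal (1 / real N ^ (CARD('n) - 1)) * emeasure \<mu> (grid_map N i -` (U \<inter> cube) \<inter> cube))"
    using markov_fixed_iff[OF N1 d \<mu>] fixed by blast
  also have "\<dots> = (\<Sum>i\<in>zero_sum_indices N.
      ennreal (1 / real N ^ (CARD('n) - 1)) * emeasure \<mu> ((grid_map N i -` U) \<inter> cube))"
  proof (intro sum.cong refl arg_cong2[where f = "(*)"] arg_cong2[where f = emeasure])
    fix i :: "'n \<Rightarrow> nat" assume "i \<in> zero_sum_indices N"
    then show "grid_map N i -` (U \<inter> cube) \<inter> cube = (grid_map N i -` U) \<inter> cube"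
      using grid_map_in_cube[of i N] by (auto simp: zero_sum_indices_def)
  qed
  finally show ?thesis .
qed

lemma open_vimage_grid_map: "open U \<Longrightarrow> open (grid_map N (i :: 'n \<Rightarrow> nat) -` U)"
  by (rule open_vimage[OF _ continuous_on_grid_map])

lemma compact_support: "compact (measure_support \<mu>)"
proof -
  have "closed (space \<mu>)" by (simp add: cube_probsD(3)[OF \<mu>] compact_imp_closed compact_cube)
  then have "closed (measure_support \<mu>)" by (rule closed_measure_support)
  moreover have "bounded (measure_support \<mu>)"
    using compact_imp_bounded[OF compact_cube] cube_probsD(3)[OF \<mu>]
    by (rule_tac bounded_subset) (auto simp: measure_support_def)
  ultimately show ?thesis by (simp add: compact_eq_bounded_closed)
qed

lemma support_in_sets: "measure_support \<mu> \<in> sets \<mu>"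
proof -
  have "cube \<inter> measure_support \<mu> \<in> sets cube_borel"
    unfolding cube_borel_def sets_restrict_space
    by (intro imageI borel_closed compact_imp_closed compact_support)
  moreover have "cube \<inter> measure_support \<mu> = measure_support \<mu>" using cube_probsD(3)[OF \<mu>] by (auto simp: measure_support_def)
  ultimately show ?thesis using cube_probsD(2)[OF \<mu>] by simp
qed

lemma null_off_support: "emeasure \<mu> (cube - measure_support \<mu>) = 0"
  using null_Diff_measure_support[of \<mu> cube] cube_probsD[OF \<mu>]
  by (auto simp: cube_borel_def)

lemma emeasure_support: "emeasure \<mu> (measure_support \<mu>) = 1"
proof -
  have K: "measure_support \<mu> \<subseteq> cube" using cube_probsD(3)[OF \<mu>] by (auto simp: measure_support_def)
  interpret prob_space \<mu> by (rule cube_probsD(1)[OF \<mu>])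
  have "emeasure \<mu> cube = emeasure \<mu> (measure_support \<mu>) + emeasure \<mu> (cube - measure_support \<mu>)"
    using support_in_sets cube_probsD(3)[OF \<mu>] K sets.compl_sets[OF support_in_sets]
    by (subst plus_emeasure) (auto intro!: arg_cong2[where f = emeasure])
  then show ?thesis using emeasure_space_1 cube_probsD(3)[OF \<mu>] null_off_support by simp
qed

lemma support_nonempty: "measure_support \<mu> \<noteq> {}"
  using emeasure_support by force

text \<open>
  By the fixed point equation an open set \<open>U\<close> has positive measure iff one of its preimages under the
  maps has.  For the inclusion from left to right, apply this to the complement of the right-hand
  side, all of whose preimages miss the support.
\<close>

lemma support_eq_Union: "measure_support \<mu> = (\<Union>i\<in>zero_sum_indices N. grid_map N i ` measure_support \<mu>)"
proof (intro equalityI subsetI)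
  have N1: "N \<ge> 1" using N by simp
  fix x assume "x \<in> (\<Union>i\<in>zero_sum_indices N. grid_map N i ` measure_support \<mu>)"
  then obtain i z where i: "i \<in> zero_sum_indices N" and z: "z \<in> measure_support \<mu>" and x: "x = grid_map N i z" by blast
  have zc: "z \<in> cube" using z cube_probsD(3)[OF \<mu>] by (auto simp: measure_support_def)
  have "x \<in> cube" using grid_map_in_cube[OF _ zc] i x by (auto simp: zero_sum_indices_def)
  moreover have "emeasure \<mu> (U \<inter> cube) > 0" if U: "open U" "x \<in> U" for U
  proof -
    have "0 < emeasure \<mu> ((grid_map N i -` U) \<inter> cube)"
      using measure_support_emeasure_pos[OF z open_vimage_grid_map[OF U(1)]] U x cube_probsD(3)[OF \<mu>] by simp
    then have "0 < ennreal (1 / real N ^ (CARD('n) - 1)) * emeasure \<mu> ((grid_map N i -` U) \<inter> cube)"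
      using N1 by (simp add: ennreal_zero_less_mult_iff)
    also have "\<dots> \<le> emeasure \<mu> (U \<inter> cube)"
      unfolding emeasure_fixed[OF U(1)]
      by (rule member_le_sum[OF i]) (simp_all add: finite_zero_sum_indices)
    finally show ?thesis .
  qed
  ultimately show "x \<in> measure_support \<mu>" using cube_probsD(3)[OF \<mu>] by (simp add: measure_support_def)
next
  fix x assume x: "x \<in> measure_support \<mu>"
  let ?Y = "\<Union>i\<in>zero_sum_indices N. grid_map N i ` measure_support \<mu>"
  show "x \<in> ?Y"
  proof (rule ccontr)
    assume "x \<notin> ?Y"
    have "compact ?Y"
      by (intro compact_UN finite_zero_sum_indices compact_continuous_image continuous_on_grid_map compact_support)
    then have U: "open (- ?Y)" by (rule open_Compl[OF compact_imp_closed])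
    have "emeasure \<mu> ((grid_map N i -` (- ?Y)) \<inter> cube) = 0" if "i \<in> zero_sum_indices N" for i
    proof -
      have "emeasure \<mu> ((grid_map N i -` (- ?Y)) \<inter> cube) \<le> emeasure \<mu> (cube - measure_support \<mu>)"
      proof (rule emeasure_mono)
        show "grid_map N i -` (- ?Y) \<inter> cube \<subseteq> cube - measure_support \<mu>" using that by blast
        show "cube - measure_support \<mu> \<in> sets \<mu>"
          using sets.compl_sets[OF support_in_sets] cube_probsD(3)[OF \<mu>] by simp
      qed
      then show ?thesis using null_off_support by simp
    qed
    then have "emeasure \<mu> ((- ?Y) \<inter> cube) = 0" unfolding emeasure_fixed[OF U] by simp
    then show False
      using measure_support_emeasure_pos[OF x U] \<open>x \<notin> ?Y\<close> cube_probsD(3)[OF \<mu>] by simp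
  qed
qed

lemma self_similar_support: "self_similar (measure_support \<mu>)"
proof -
  let ?S = "zero_sum_indices N :: ('n \<Rightarrow> nat) set"
  have N1: "N \<ge> 1" using N by simp
  obtain h where h: "bij_betw h {1..card ?S} ?S"
    using ex_bij_betw_nat_finite_1[OF finite_zero_sum_indices] by blast
  have "2 \<le> N ^ 1" using N by simp
  also have "\<dots> \<le> N ^ (CARD('n) - 1)" using N d by (intro power_increasing) auto
  finally have "card ?S \<ge> 2" by (simp add: card_zero_sum_indices[OF N1])
  moreover have "measure_support \<mu> = (\<Union>k\<in>{1..card ?S}. grid_map N (h k) ` measure_support \<mu>)"
  proof -
    have "(\<Union>k\<in>{1..card ?S}. grid_map N (h k) ` measure_support \<mu>) = (\<Union>i\<in>h ` {1..card ?S}. grid_map N i ` measure_support \<mu>)" by blast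
    also have "\<dots> = (\<Union>i\<in>?S. grid_map N i ` measure_support \<mu>)" by (simp only: bij_betw_imp_surj_on[OF h])
    also have "\<dots> = measure_support \<mu>" by (rule support_eq_Union[symmetric])
    finally show ?thesis by (rule sym)
  qed
  ultimately show ?thesis
    unfolding self_similar_def
    using support_nonempty compact_support N
    by (intro conjI exI[of _ "card ?S"] exI[of _ "\<lambda>k. grid_map N (h k)"] exI[of _ "\<lambda>_. 1 / real N"])
      (auto simp: dist_grid_map)
qed

text \<open>
  The volume of the support is at most \<open>N ^ (d - 1) * (1 / N) ^ d = 1 / N\<close> times itself, and it is
  finite.
\<close>

lemma lborel_null_support: "emeasure lborel (measure_support \<mu>) = 0"
proof -
  let ?S = "zero_sum_indices N :: ('n \<Rightarrow> nat) set"
  have N1: "N \<ge> 1" using N by simp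
  have Kb: "measure_support \<mu> \<in> sets borel" by (intro borel_closed compact_imp_closed compact_support)
  have fin: "emeasure lborel (measure_support \<mu>) < \<infinity>" using emeasure_compact_finite[OF compact_support] by simp
  have im: "grid_map N i ` measure_support \<mu> \<in> sets borel" for i :: "'n \<Rightarrow> nat"
    by (intro borel_closed compact_imp_closed compact_continuous_image continuous_on_grid_map compact_support)
  have scale: "emeasure lborel (grid_map N i ` measure_support \<mu>) = ennreal ((1 / real N) ^ CARD('n)) * emeasure lborel (measure_support \<mu>)"
    for i :: "'n \<Rightarrow> nat"
  proof -
    have "grid_map N i = (\<lambda>x. (1 / real N) *\<^sub>R x + grid_map N i 0)"
      by (rule ext, rule grid_map_eq_affine)
    then have "emeasure lebesgue (grid_map N i ` measure_support \<mu>) = ennreal (\<bar>1 / real N\<bar> ^ DIM(real ^ 'n)) * emeasure lebesgue (measure_support \<mu>)"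
      by (metis emeasure_lebesgue_affine)
    then show ?thesis using Kb im by (simp add: emeasure_completion)
  qed
  have "emeasure lborel (measure_support \<mu>) = emeasure lborel (\<Union>i\<in>?S. grid_map N i ` measure_support \<mu>)"
    using support_eq_Union by simp
  also have "\<dots> \<le> (\<Sum>i\<in>?S. emeasure lborel (grid_map N i ` measure_support \<mu>))"
    using im by (intro emeasure_subadditive_finite finite_zero_sum_indices) auto
  also have "\<dots> = ennreal (real (N ^ (CARD('n) - 1)) * (1 / real N) ^ CARD('n)) * emeasure lborel (measure_support \<mu>)"
    by (simp add: scale card_zero_sum_indices[OF N1] ennreal_mult' ennreal_of_nat_eq_real_of_nat mult.assoc)
  also have "real (N ^ (CARD('n) - 1)) * (1 / real N) ^ CARD('n) = 1 / real N"
    using N1 d by (cases "CARD('n)") (simp_all add: power_divide)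
  finally have le: "emeasure lborel (measure_support \<mu>) \<le> ennreal (1 / real N) * emeasure lborel (measure_support \<mu>)" .
  obtain r where r: "emeasure lborel (measure_support \<mu>) = ennreal r" "r \<ge> 0"
    using fin by (cases "emeasure lborel (measure_support \<mu>)") auto
  have "r \<le> 1 / real N * r"
    using le r by (simp add: ennreal_mult[symmetric] ennreal_le_iff)
  moreover have "1 / real N * r \<le> 1 / 2 * r" using N r(2) by (intro mult_right_mono) (auto simp: field_simps)
  ultimately have "r = 0" using r(2) by linarith
  then show ?thesis using r by simp
qed

lemma singular_support: "singular_wrt \<mu> cube_lebesgue"
  unfolding singular_wrt_def
proof (intro bexI[of _ "cube - measure_support \<mu>"] conjI)
  have K: "measure_support \<mu> \<subseteq> cube" using cube_probsD(3)[OF \<mu>] by (auto simp: measure_support_def)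
  show "emeasure \<mu> (cube - measure_support \<mu>) = 0" by (rule null_off_support)
  have "space cube_lebesgue - (cube - measure_support \<mu>) = measure_support \<mu>" using K by (auto simp: cube_lebesgue_def space_restrict_space)
  then show "emeasure cube_lebesgue (space cube_lebesgue - (cube - measure_support \<mu>)) = 0"
    using lborel_null_support K by (simp add: cube_lebesgue_def emeasure_restrict_space)
  have "cube - measure_support \<mu> \<in> sets \<mu>"
    using sets.compl_sets[OF support_in_sets] cube_probsD(3)[OF \<mu>] by simp
  moreover have "sets (cube_lebesgue :: (real ^ 'n) measure) = sets \<mu>"
    using cube_probsD(2)[OF \<mu>] by (simp add: cube_lebesgue_def cube_borel_def sets_restrict_space)
  ultimately show "cube - measure_support \<mu> \<in> sets \<mu> \<inter> sets cube_lebesgue" by simp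
qed

text \<open>
  Apply the decomposition of the support into its copies \<open>n\<close> times.
\<close>

lemma support_covers:
  "\<exists>F. finite F \<and> card F \<le> (N ^ (CARD('n) - 1)) ^ n \<and> measure_support \<mu> \<subseteq> \<Union>F \<and>
    (\<forall>C\<in>F. bounded C \<and> diameter C \<le> diameter (measure_support \<mu>) / real N ^ n)"
proof -
  let ?S = "zero_sum_indices N :: ('n \<Rightarrow> nat) set" and ?D = "diameter (measure_support \<mu>)"
  have N1: "N \<ge> 1" using N by simp
  note comp = compact_support
  have D: "dist x y \<le> ?D" if "x \<in> measure_support \<mu>" "y \<in> measure_support \<mu>" for x y
    using diameter_bounded_bound[OF compact_imp_bounded[OF comp]] that by blast
  have D0: "0 \<le> ?D" by (rule diameter_ge_0[OF compact_imp_bounded[OF comp]])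
  have "\<exists>F. finite F \<and> card F \<le> (N ^ (CARD('n) - 1)) ^ n \<and> measure_support \<mu> \<subseteq> \<Union>F \<and>
    (\<forall>C\<in>F. \<forall>x\<in>C. \<forall>y\<in>C. dist x y \<le> ?D / real N ^ n)"
  proof (induction n)
    case 0
    show ?case using D by (intro exI[of _ "{measure_support \<mu>}"]) auto
  next
    case (Suc n)
    then obtain F where F: "finite F" "card F \<le> (N ^ (CARD('n) - 1)) ^ n" "measure_support \<mu> \<subseteq> \<Union>F"
      "\<And>C x y. C \<in> F \<Longrightarrow> x \<in> C \<Longrightarrow> y \<in> C \<Longrightarrow> dist x y \<le> ?D / real N ^ n" by blast
    let ?F = "(\<lambda>(i, C). grid_map N i ` C) ` (?S \<times> F)"
    have "card ?F \<le> card ?S * card F"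
      using card_image_le[of "?S \<times> F"] F(1) by (simp add: finite_zero_sum_indices card_cartesian_product)
    also have "\<dots> \<le> (N ^ (CARD('n) - 1)) ^ Suc n"
      using F(2) by (simp add: card_zero_sum_indices[OF N1])
    finally have "card ?F \<le> (N ^ (CARD('n) - 1)) ^ Suc n" .
    moreover have "measure_support \<mu> \<subseteq> \<Union>?F"
    proof
      fix x assume "x \<in> measure_support \<mu>"
      then have "x \<in> (\<Union>i\<in>?S. grid_map N i ` measure_support \<mu>)" using support_eq_Union by blast
      then obtain i z where "i \<in> ?S" "z \<in> measure_support \<mu>" "x = grid_map N i z" by blast
      moreover then obtain C where "C \<in> F" "z \<in> C" using F(3) by blast
      ultimately show "x \<in> \<Union>?F" by force
    qed
    moreover have "dist x y \<le> ?D / real N ^ Suc n" if C: "C \<in> ?F" "x \<in> C" "y \<in> C" for C x y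
    proof -
      obtain i C' x' y' where *: "C' \<in> F" "x' \<in> C'" "y' \<in> C'" "x = grid_map N i x'" "y = grid_map N i y'"
        using C by auto
      have "1 / real N * dist x' y' \<le> 1 / real N * (?D / real N ^ n)"
        using F(4)[OF *(1-3)] by (intro mult_left_mono) auto
      then show ?thesis by (simp add: * dist_grid_map)
    qed
    ultimately show ?case using F(1) finite_zero_sum_indices by (intro exI[of _ ?F]) blast
  qed
  then obtain F where F: "finite F" "card F \<le> (N ^ (CARD('n) - 1)) ^ n" "measure_support \<mu> \<subseteq> \<Union>F"
    "\<And>C x y. C \<in> F \<Longrightarrow> x \<in> C \<Longrightarrow> y \<in> C \<Longrightarrow> dist x y \<le> ?D / real N ^ n" by blast
  have "bounded C \<and> diameter C \<le> ?D / real N ^ n" if "C \<in> F" for C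
  proof
    show "bounded C" using F(4)[OF that] unfolding bounded_two_points by blast
    show "diameter C \<le> ?D / real N ^ n"
      using F(4)[OF that] D0 N by (intro diameter_le) (auto simp: dist_norm)
  qed
  then show ?thesis using F(1-3) by blast
qed

lemma hausdorff_dimension_support:
  fixes j0 :: 'n
  assumes face: "distr \<mu> (face_borel j0) (proj_del j0) = face_lebesgue j0"
  shows "hausdorff_dimension (measure_support \<mu>) = of_nat (CARD('n) - 1)"
proof -
  let ?k = "CARD('n) - 1"
  have "hausdorff_dimension (measure_support \<mu>) = ennreal (real ?k)"
  proof (rule hausdorff_dimension_eqI)
    fix s assume s: "s > real ?k"
    have "real (N ^ ?k) = real N powr real ?k"
      unfolding of_nat_power using N by (intro powr_realpow[symmetric]) simp
    also have "\<dots> < real N powr s" using N s by (intro powr_less_mono) auto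
    finally have lt: "real (N ^ ?k) < real N powr s" .
    show "hausdorff_measure s (measure_support \<mu>) = 0"
    proof (rule hausdorff_measure_eq_0_of_covers[OF support_covers _ _ _ lt])
      show "0 \<le> diameter (measure_support \<mu>)"
        by (rule diameter_ge_0[OF compact_imp_bounded[OF compact_support]])
      show "1 < real N" using N by simp
      show "0 < s" using s by (rule le_less_trans[rotated]) simp
    qed
  next
    fix s assume "0 \<le> s" "s < real ?k"
    then show "hausdorff_measure s (measure_support \<mu>) \<noteq> 0"
      using hausdorff_measure_pos_of_uniform_face[OF d \<mu> face support_in_sets
          emeasure_support, of s] by simp
  qed simp
  then show ?thesis by (simp add: ennreal_of_nat_eq_real_of_nat)
qed

end

section \<open>The measure with digit sums divisible by \<open>N\<close>\<close>

theorem theorem4p3: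
  fixes N :: nat and \<tau> :: "('n::finite \<Rightarrow> nat) \<Rightarrow> real" and \<mu> :: "(real ^ 'n) measure"
  assumes "CARD('n) \<ge> 3" and "N \<ge> 2"
  defines "\<tau> \<equiv> mod_matrix N"
  defines "\<mu> \<equiv> invariant_measure (\<lambda>_. N) \<tau>"
  shows "\<tau> \<in> uniform_matrices N \<and>
    \<mu> \<in> stochastic_measures_uniform_faces \<and>
    (singular_wrt \<mu> cube_lebesgue \<and>
     self_similar (measure_support \<mu>) \<and>
     hausdorff_dimension (measure_support \<mu>) = of_nat (CARD('n) - 1)) \<and>
    (\<forall>(M :: 'w measure) X.
       prob_space M \<and> X \<in> measurable M cube_borel \<and> distr M cube_borel X = \<mu> \<longrightarrow>
       (\<forall>j. \<exists>g \<in> measurable (face_borel j) unit_borel.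
          AE \<omega> in M. X \<omega> $ j = g (proj_del j (X \<omega>))))"
proof -
  have N: "N \<ge> 2" and d: "CARD('n) \<ge> 2" using assms(1,2) by simp_all
  have graph: "\<mu> = completion_graph_measure N j0" for j0
    unfolding \<mu>_def \<tau>_def by (rule invariant_measure_eq_graph[OF N d])
  have \<mu>: "\<mu> \<in> cube_probs"
    unfolding graph[of undefined] by (rule completion_graph_measure_in_cube_probs[OF N])
  have fixed: "markov_operator (\<lambda>_. N) (mod_matrix N) \<mu> = \<mu>"
    unfolding graph[of undefined] by (rule completion_graph_measure_fixed[OF N d])
  have faces: "\<mu> \<in> stochastic_measures_uniform_faces"
    unfolding \<mu>_def \<tau>_def by (rule invariant_measure_uniform_faces[OF N d])
  then have face: "distr \<mu> (face_borel j0) (proj_del j0) = face_lebesgue j0" for j0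
    by (simp add: stochastic_measures_uniform_faces_def)
  have determined: "\<exists>g \<in> measurable (face_borel j) unit_borel. AE \<omega> in M. X \<omega> $ j = g (proj_del j (X \<omega>))"
    if "X \<in> measurable M cube_borel" "distr M cube_borel X = \<mu>" for M :: "'w measure" and X j
  proof (rule bexI)
    show "AE \<omega> in M. X \<omega> $ j = completion N (-{j}) (proj_del j (X \<omega>))"
      using that unfolding \<mu>_def \<tau>_def by (rule coordinate_determined[OF N d])
    show "completion N (-{j}) \<in> measurable (face_borel j) unit_borel"
      unfolding face_borel_def by (rule measurable_completion[OF N])
  qed
  show ?thesis
    using mod_matrix_uniform[OF d N] faces singular_support[OF N d \<mu> fixed] self_similar_support[OF N d \<mu> fixed]
      hausdorff_dimension_support[OF N d \<mu> fixed face] determined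
    unfolding \<tau>_def by blast
qed

end
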